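(* Let $k\geq 4$ and $n>k$ be integers. If $G$ is a $2$-connected graph on $n$ vertices with chromatic number $\chi(G)=k$, independence number $\alpha(G)=2$ and connectivity $\kappa(G)=2$, then for every integer $x\geq k$, $$P(G,x)\leq (x-1)_{k-1}\big((x-1)^{n-k+1}+(-1)^{n-k}\big),$$ with equality if and only if $G\cong G_{k+1,k}$ or $G\cong G_{k+2,k}$.
   Context: All graphs are finite and simple. $P(G,x)$ denotes the chromatic polynomial of $G$, i.e., for a positive integer $x$ the number of proper colorings $c:V(G)\to\{1,\dots,x\}$. $(x)_m=x(x-1)\cdots(x-m+1)$ denotes the falling factorial. $\alpha(G)$ is the independence number and $\kappa(G)$ the vertex connectivity. For $m\ge k$, $G_{m,k}$ is the graph on $m$ vertices obtained from a $k$-clique by adding a path with $m-k$ new internal vertices (each of degree $2$) whose endpoints are two distinct vertices of the clique. *)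

theory Defs
  imports "Graph_Theory.Graph_Theory" "HOL-Library.FuncSet"
begin

text \<open>Finite simple graphs are values of type \<^typ>\<open>'a pair_pre_digraph\<close> satisfying
  \<^const>\<open>pair_graph\<close>: an edge \<open>{u, v}\<close> is represented by the two arcs \<open>(u, v)\<close> and \<open>(v, u)\<close>.\<close>

definition proper_colorings :: "'a pair_pre_digraph \<Rightarrow> nat \<Rightarrow> ('a \<Rightarrow> nat) set" where
  "proper_colorings G x =
     {c \<in> pverts G \<rightarrow>\<^sub>E {1..x}. \<forall>(u, v) \<in> parcs G. c u \<noteq> c v}"

text \<open>The chromatic polynomial, as a function on the natural numbers.\<close>

definition chromatic_poly :: "'a pair_pre_digraph \<Rightarrow> nat \<Rightarrow> nat" where
  "chromatic_poly G x = card (proper_colorings G x)"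

definition chromatic_number :: "'a pair_pre_digraph \<Rightarrow> nat" where
  "chromatic_number G = (LEAST k. proper_colorings G k \<noteq> {})"

definition independent_set :: "'a pair_pre_digraph \<Rightarrow> 'a set \<Rightarrow> bool" where
  "independent_set G S \<longleftrightarrow> S \<subseteq> pverts G \<and> (\<forall>u\<in>S. \<forall>v\<in>S. (u, v) \<notin> parcs G)"

definition independence_number :: "'a pair_pre_digraph \<Rightarrow> nat" where
  "independence_number G = Max {card S | S. independent_set G S}"

definition k_connected :: "nat \<Rightarrow> 'a pair_pre_digraph \<Rightarrow> bool" where
  "k_connected k G \<longleftrightarrow> k < card (pverts G) \<and>
     (\<forall>S \<subseteq> pverts G. card S < k \<longrightarrow>
        Digraph_Component.connected (with_proj G \<restriction> (pverts G - S)))"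

text \<open>The least number of vertices whose deletion leaves a disconnected graph or at most one
  vertex, so that a complete graph on \<open>n\<close> vertices has connectivity \<open>n - 1\<close>.\<close>

definition vertex_connectivity :: "'a pair_pre_digraph \<Rightarrow> nat" where
  "vertex_connectivity G =
     (LEAST m. \<exists>S \<subseteq> pverts G. card S = m \<and>
        (\<not> Digraph_Component.connected (with_proj G \<restriction> (pverts G - S)) \<or>
         card (pverts G - S) \<le> 1))"

definition falling_fact :: "int \<Rightarrow> nat \<Rightarrow> int" where
  "falling_fact x m = (\<Prod>i<m. x - int i)"

text \<open>The graph \<open>G\<^sub>m\<^sub>,\<^sub>k\<close> for \<open>2 \<le> k \<le> m\<close>: the clique is on \<open>0, \<dots>, k - 1\<close> and the
  added path is \<open>0, k, k + 1, \<dots>, m - 1, 1\<close>. For \<open>m = k\<close> the path is the clique edge \<open>{0, 1}\<close>.\<close>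

definition clique_with_ear :: "nat \<Rightarrow> nat \<Rightarrow> nat pair_pre_digraph" where
  "clique_with_ear m k =
     (let p = 0 # [k..<m] @ [1]; r = set (zip p (tl p))
      in \<lparr> pverts = {0..<m},
           parcs = {(i, j). i < k \<and> j < k \<and> i \<noteq> j} \<union> r \<union> r\<inverse> \<rparr>)"

definition graph_iso :: "'a pair_pre_digraph \<Rightarrow> 'b pair_pre_digraph \<Rightarrow> bool" (infix \<open>\<simeq>\<^sub>G\<close> 50) where
  "G \<simeq>\<^sub>G H \<longleftrightarrow> digraph_iso (with_proj G) (with_proj H)"

end

theory Submission
  imports Defs
begin

text \<open>Let \<open>{u, v}\<close> be a vertex cut. As \<open>\<alpha>(G) = 2\<close>, the rest of \<open>G\<close> consists of two cliques
  \<open>A\<close> and \<open>B\<close>, and each of \<open>u\<close>, \<open>v\<close> is complete to \<open>A\<close> or to \<open>B\<close>. Explicit colourings show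
  that \<open>G\<close> then has a clique with \<open>k = \<chi>(G)\<close> vertices, apart from one family (for \<open>k = 3\<close> the
  5-cycle) with \<open>|A| = |B| + 1 = k - 1\<close>, whose chromatic polynomial is computed exactly and is too small.

  Given a \<open>k\<close>-clique \<open>K\<close>, colour \<open>K\<close> first and the other \<open>j = n - k\<close> vertices along a search order,
  so that each of them has at most \<open>x - 1\<close> choices. One vertex that closes a triangle on arrival
  improves the count to \<open>(x)\<^sub>k (x - 2) (x - 1)\<^sup>j\<^sup>-\<^sup>1\<close>, which is below the bound when \<open>j \<ge> 2\<close>.
  If no vertex outside \<open>K\<close> has two neighbours in \<open>K\<close>, then \<open>\<alpha>(G) = 2\<close> makes the outside a clique,
  which contains a triangle unless \<open>G\<close> is \<open>G\<^sub>k\<^sub>+\<^sub>2\<^sub>,\<^sub>k\<close>.\<close>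

section \<open>Counting colourings vertex by vertex\<close>

text \<open>Induced subgraphs enter only through the vertex set \<open>W\<close>, over a fixed arc
  relation \<open>E\<close>, so that vertices can be added one at a time without building
  graphs.\<close>

definition colorings_on :: "('a \<times> 'a) set \<Rightarrow> 'a set \<Rightarrow> nat \<Rightarrow> ('a \<Rightarrow> nat) set" where
  "colorings_on E W x = {c \<in> W \<rightarrow>\<^sub>E {1..x}. \<forall>u\<in>W. \<forall>v\<in>W. (u, v) \<in> E \<longrightarrow> c u \<noteq> c v}"

definition clique_set :: "('a \<times> 'a) set \<Rightarrow> 'a set \<Rightarrow> bool" where
  "clique_set E K \<longleftrightarrow> (\<forall>u\<in>K. \<forall>v\<in>K. u \<noteq> v \<longrightarrow> (u, v) \<in> E)"

definition available :: "('a \<times> 'a) set \<Rightarrow> 'a set \<Rightarrow> nat \<Rightarrow> ('a \<Rightarrow> nat) \<Rightarrow> 'a \<Rightarrow> nat set" where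
  "available E W x c w = {1..x} - c ` {v \<in> W. (w, v) \<in> E}"

section \<open>Falling factorials and partial colourings\<close>

lemma falling_fact_0 [simp]: "falling_fact x 0 = 1"
  by (simp add: falling_fact_def)

lemma falling_fact_Suc: "falling_fact x (Suc m) = falling_fact x m * (x - int m)"
  by (simp add: falling_fact_def)

lemma falling_fact_Suc_left: "falling_fact x (Suc m) = x * falling_fact (x - 1) m"
  unfolding falling_fact_def
  by (simp only: prod.lessThan_Suc_shift) (simp add: algebra_simps)

lemma falling_fact_pos: "int m \<le> x \<Longrightarrow> falling_fact x m > 0"
  unfolding falling_fact_def by (intro prod_pos) auto

text \<open>The condition \<open>int m \<le> x + 1\<close> keeps every factor x - i with i < m
  nonnegative, as the factorwise comparison with x requires.\<close>

lemma falling_fact_le_power: "int m \<le> x + 1 \<Longrightarrow> falling_fact x m \<le> x ^ m"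
  unfolding falling_fact_def
  using prod_mono[of "{..<m}" "\<lambda>i. x - int i" "\<lambda>_. x"] by simp

lemma finite_colorings_on [simp]: "finite W \<Longrightarrow> finite (colorings_on E W x)"
  unfolding colorings_on_def by (rule finite_subset[of _ "W \<rightarrow>\<^sub>E {1..x}"]) (auto intro: finite_PiE)

lemma colorings_on_empty [simp]: "colorings_on E {} x = {\<lambda>_. undefined}"
  by (auto simp: colorings_on_def)

lemma finite_available [simp]: "finite (available E W x c w)"
  by (simp add: available_def)

lemma colorings_on_range: "c \<in> colorings_on E W x \<Longrightarrow> v \<in> W \<Longrightarrow> c v \<in> {1..x}"
  by (auto simp: colorings_on_def)

lemma colorings_on_neq:
  "c \<in> colorings_on E W x \<Longrightarrow> u \<in> W \<Longrightarrow> v \<in> W \<Longrightarrow> (u, v) \<in> E \<Longrightarrow> c u \<noteq> c v"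
  by (auto simp: colorings_on_def)

lemma colorings_on_inj_on:
  assumes "c \<in> colorings_on E W x" "clique_set E K" "K \<subseteq> W"
  shows "inj_on c K"
  using assms by (fastforce simp: inj_on_def clique_set_def dest: colorings_on_neq)

lemma card_available:
  assumes "finite W" "c \<in> colorings_on E W x"
  shows "int (card (available E W x c w)) = int x - int (card (c ` {v \<in> W. (w, v) \<in> E}))"
proof -
  let ?S = "c ` {v \<in> W. (w, v) \<in> E}"
  have "?S \<subseteq> {1..x}" using colorings_on_range[OF assms(2)] by blast
  moreover from this have "card ?S \<le> x" using card_mono[of "{1..x}" ?S] by simp
  ultimately show ?thesis
    unfolding available_def by (simp add: card_Diff_subset finite_subset[of ?S "{1..x}"])
qed

locale loopfree_sym_rel =
  fixes E :: "('a \<times> 'a) set"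
  assumes E_sym: "(u, v) \<in> E \<Longrightarrow> (v, u) \<in> E"
    and E_irrefl: "(u, u) \<notin> E"
begin

text \<open>A colouring of \<open>insert w W\<close> amounts to its restriction to \<open>W\<close>
  together with an available colour for \<open>w\<close>. The weight \<open>F\<close> allows several
  vertices to be peeled off in turn while keeping track of the colours already chosen.\<close>

lemma sum_colorings_insert:
  fixes F :: "('a \<Rightarrow> nat) \<Rightarrow> int"
  assumes "finite W" "w \<notin> W"
  shows "(\<Sum>d\<in>colorings_on E (insert w W) x. F d) =
    (\<Sum>c\<in>colorings_on E W x. \<Sum>i\<in>available E W x c w. F (c(w := i)))"
proof -
  have "(\<Sum>c\<in>colorings_on E W x. \<Sum>i\<in>available E W x c w. F (c(w := i))) =
    (\<Sum>(c, i)\<in>Sigma (colorings_on E W x) (\<lambda>c. available E W x c w). F (c(w := i)))"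
    using assms by (subst sum.Sigma) auto
  also have "\<dots> = (\<Sum>d\<in>colorings_on E (insert w W) x. F d)"
  proof (rule sum.reindex_bij_witness[where j = "\<lambda>(c, i). c(w := i)"
        and i = "\<lambda>d. (restrict d W, d w)"])
    fix p assume "p \<in> Sigma (colorings_on E W x) (\<lambda>c. available E W x c w)"
    then obtain c i where p: "p = (c, i)" "c \<in> colorings_on E W x" "i \<in> available E W x c w"
      by auto
    then have ext: "c \<in> extensional W" by (auto simp: colorings_on_def PiE_def)
    have "restrict (c(w := i)) W = c"
      using ext assms(2) by (auto simp: restrict_def fun_eq_iff extensional_def)
    then show "(restrict ((case p of (c, i) \<Rightarrow> c(w := i))) W, (case p of (c, i) \<Rightarrow> c(w := i)) w) = p"
      using p by simp
    have "c(w := i) \<in> insert w W \<rightarrow>\<^sub>E {1..x}"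
      using p by (auto simp: colorings_on_def available_def PiE_def extensional_def Pi_def)
    moreover have "\<forall>a\<in>insert w W. \<forall>b\<in>insert w W. (a, b) \<in> E \<longrightarrow> (c(w := i)) a \<noteq> (c(w := i)) b"
      using p assms(2) E_irrefl E_sym
      by (auto simp: colorings_on_def available_def) 
    ultimately show "(case p of (c, i) \<Rightarrow> c(w := i)) \<in> colorings_on E (insert w W) x"
      unfolding p(1) colorings_on_def by simp
    show "F (case p of (c, i) \<Rightarrow> c(w := i)) = (case p of (c, i) \<Rightarrow> F (c(w := i)))"
      using p by simp
  next
    fix d assume d: "d \<in> colorings_on E (insert w W) x"
    then have ext: "d \<in> extensional (insert w W)" by (auto simp: colorings_on_def PiE_def)
    show "(case (restrict d W, d w) of (c, i) \<Rightarrow> c(w := i)) = d"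
      using ext by (auto simp: fun_eq_iff extensional_def restrict_def)
    show "(restrict d W, d w) \<in> Sigma (colorings_on E W x) (\<lambda>c. available E W x c w)"
      using d assms by (auto simp: colorings_on_def available_def)
  qed
  finally show ?thesis by simp
qed

lemma card_colorings_insert:
  assumes "finite W" "w \<notin> W"
  shows "int (card (colorings_on E (insert w W) x)) =
    (\<Sum>c\<in>colorings_on E W x. int x - int (card (c ` {v \<in> W. (w, v) \<in> E})))"
proof -
  have "int (card (colorings_on E (insert w W) x)) =
    (\<Sum>c\<in>colorings_on E W x. int (card (available E W x c w)))"
    using sum_colorings_insert[OF assms, of "\<lambda>_. 1" x] by simp
  then show ?thesis using assms by (simp add: card_available)
qed

text \<open>A clique of coloured neighbours carries distinct colours, all forbidden at
  \<open>w\<close>. One neighbour gives the factor x - 1, two adjacent ones give the gain x -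
  2.\<close>

lemma card_colorings_insert_le:
  assumes "finite W" "w \<notin> W" "S \<subseteq> W" "clique_set E S" "\<And>s. s \<in> S \<Longrightarrow> (w, s) \<in> E"
  shows "int (card (colorings_on E (insert w W) x))
    \<le> int (card (colorings_on E W x)) * (int x - int (card S))"
proof -
  have "int x - int (card (c ` {v \<in> W. (w, v) \<in> E})) \<le> int x - int (card S)"
    if c: "c \<in> colorings_on E W x" for c
  proof -
    have "card S = card (c ` S)"
      using colorings_on_inj_on[OF c assms(4,3)] by (simp add: card_image)
    also have "\<dots> \<le> card (c ` {v \<in> W. (w, v) \<in> E})"
      using assms by (intro card_mono image_mono) auto
    finally show ?thesis by simp
  qed
  from sum_mono[OF this] show ?thesis by (simp add: card_colorings_insert[OF assms(1,2)])
qed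

text \<open>The coloured neighbours of \<open>w\<close> are pairwise adjacent, so every colouring
  forbids the same number of colours and the count is exact.\<close>

lemma card_colorings_insert_clique_nbhd:
  assumes "finite W" "w \<notin> W" "clique_set E {v \<in> W. (w, v) \<in> E}"
  shows "int (card (colorings_on E (insert w W) x))
    = int (card (colorings_on E W x)) * (int x - int (card {v \<in> W. (w, v) \<in> E}))"
proof -
  have "card (c ` {v \<in> W. (w, v) \<in> E}) = card {v \<in> W. (w, v) \<in> E}"
    if "c \<in> colorings_on E W x" for c
    by (intro card_image colorings_on_inj_on[OF that assms(3)]) auto
  then show ?thesis by (simp add: card_colorings_insert[OF assms(1,2)])
qed

lemma card_colorings_clique:
  assumes "finite K" "clique_set E K"
  shows "int (card (colorings_on E K x)) = falling_fact (int x) (card K)"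
  using assms
proof (induction K rule: finite_induct)
  case (insert w K)
  have N: "{v \<in> K. (w, v) \<in> E} = K" and K: "clique_set E K"
    using insert.prems insert.hyps by (auto simp: clique_set_def)
  show ?case
    using insert.IH[OF K] insert.hyps K
    by (simp add: card_colorings_insert_clique_nbhd[OF insert.hyps(1,2)] N falling_fact_Suc)
qed simp

text \<open>The vertices of \<open>B\<close> see each other and, in \<open>W\<close>, exactly
  \<open>u\<close> and \<open>v\<close>, so the number of extensions depends only on whether the
  colours of \<open>u\<close> and \<open>v\<close> agree. The weight is arbitrary in the induction
  because it absorbs the factor of the last vertex.\<close>

lemma sum_colorings_join_clique:
  fixes F :: "nat \<Rightarrow> nat \<Rightarrow> int"
  assumes "finite W" "finite B" "W \<inter> B = {}" "clique_set E B" "u \<in> W" "v \<in> W"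
    and "\<And>b. b \<in> B \<Longrightarrow> {a \<in> W. (b, a) \<in> E} = {u, v}"
  shows "(\<Sum>d\<in>colorings_on E (W \<union> B) x. F (d u) (d v)) =
    (\<Sum>c\<in>colorings_on E W x.
       F (c u) (c v) * falling_fact (int x - int (card {c u, c v})) (card B))"
  using assms(2,3,4,7)
proof (induction B arbitrary: F rule: finite_induct)
  case (insert b B)
  have B: "W \<inter> B = {}" "clique_set E B" "b \<notin> W \<union> B" "finite (W \<union> B)"
    using insert assms(1) by (auto simp: clique_set_def)
  have N: "{a \<in> W \<union> B. (b, a) \<in> E} = {u, v} \<union> B"
    using insert by (auto simp: clique_set_def)
  have bn: "u \<noteq> b" "v \<noteq> b" using B assms by auto
  have "(\<Sum>d\<in>colorings_on E (W \<union> insert b B) x. F (d u) (d v)) =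
    (\<Sum>c\<in>colorings_on E (W \<union> B) x. int (card (available E (W \<union> B) x c b)) * F (c u) (c v))"
    using sum_colorings_insert[OF B(4,3), of "\<lambda>d. F (d u) (d v)" x] bn by simp
  also have "\<dots> = (\<Sum>c\<in>colorings_on E (W \<union> B) x.
     F (c u) (c v) * (int x - int (card {c u, c v}) - int (card B)))"
  proof (rule sum.cong[OF refl])
    fix c assume c: "c \<in> colorings_on E (W \<union> B) x"
    have "c u \<noteq> c a \<and> c v \<noteq> c a" if "a \<in> B" for a
    proof -
      have "(a, u) \<in> E" "(a, v) \<in> E" using insert.prems(3)[of a] that by blast+
      then show ?thesis
        using colorings_on_neq[OF c, of a u] colorings_on_neq[OF c, of a v] that assms(5,6) by auto
    qed
    then have sep: "c u \<notin> c ` B" "c v \<notin> c ` B" by auto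
    have "card (c ` ({u, v} \<union> B)) = card ({c u, c v} \<union> c ` B)" by (simp add: image_Un)
    also have "\<dots> = card {c u, c v} + card (c ` B)"
      using sep insert.hyps by (intro card_Un_disjoint) auto
    also have "card (c ` B) = card B"
      using colorings_on_inj_on[OF c B(2)] by (simp add: card_image)
    finally show "int (card (available E (W \<union> B) x c b)) * F (c u) (c v) =
       F (c u) (c v) * (int x - int (card {c u, c v}) - int (card B))"
      unfolding card_available[OF B(4) c] N by simp
  qed
  also have "\<dots> = (\<Sum>c\<in>colorings_on E W x.
     F (c u) (c v) * falling_fact (int x - int (card {c u, c v})) (card (insert b B)))"
    using insert.IH[OF B(1,2), of "\<lambda>p q. F p q * (int x - int (card {p, q}) - int (card B))"]
      insert.prems insert.hyps by (simp add: falling_fact_Suc mult_ac)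
  finally show ?case .
qed simp

end

section \<open>Colourings, cuts and isomorphisms of graphs\<close>

sublocale pair_graph \<subseteq> loopfree_sym_rel "parcs G"
proof
  show "(v, u) \<in> parcs G" if "(u, v) \<in> parcs G" for u v
    using that pair_sym_arcs by (auto simp: symmetric_def dest: symD)
  show "(u, u) \<notin> parcs G" for u
    using pair_no_loops[of "(u, u)"] by auto
qed

context pair_graph
begin

section \<open>Chromatic number, cliques and independent sets\<close>

lemma proper_colorings_eq: "proper_colorings G x = colorings_on (parcs G) (pverts G) x"
  unfolding proper_colorings_def colorings_on_def by (auto dest: in_arcsD1 in_arcsD2)

text \<open>Colours may have any type and are relabelled injectively into {1..m}; the colourings
  below use vertices of the graph as colours.\<close>

lemma chromatic_number_le:
  assumes "\<And>u v. (u, v) \<in> parcs G \<Longrightarrow> c u \<noteq> c v" "card (c ` pverts G) \<le> m"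
  shows "chromatic_number G \<le> m"
proof -
  have "finite (c ` pverts G)" using pair_finite_verts by simp
  with assms(2) obtain g where g: "g ` (c ` pverts G) \<subseteq> {1..m}" "inj_on g (c ` pverts G)"
    using card_le_inj[of "c ` pverts G" "{1..m}"] by auto
  have "g (c u) \<noteq> g (c v)" if "(u, v) \<in> parcs G" for u v
    using that assms(1)[OF that] inj_on_eq_iff[OF g(2)] in_arcsD1[OF that] in_arcsD2[OF that] by simp
  then have "restrict (g \<circ> c) (pverts G) \<in> proper_colorings G m"
    using g(1) by (auto simp: proper_colorings_eq colorings_on_def)
  then show ?thesis unfolding chromatic_number_def by (intro Least_le) auto
qed

lemma clique_card_le_chromatic_number:
  assumes "K \<subseteq> pverts G" "clique_set (parcs G) K"
  shows "card K \<le> chromatic_number G"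
proof -
  \<comment> \<open>The chromatic number is a \<open>LEAST\<close>, so some proper colouring must
    exist first; an injective numbering of the vertices is one.\<close>
  obtain g where g: "g ` pverts G \<subseteq> {1..card (pverts G)}" "inj_on g (pverts G)"
    using card_le_inj[of "pverts G" "{1..card (pverts G)}"] pair_finite_verts by auto
  have "g u \<noteq> g v" if "(u, v) \<in> parcs G" for u v
    using inj_on_eq_iff[OF g(2)] in_arcsD1[OF that] in_arcsD2[OF that] that E_irrefl by metis
  then have "restrict g (pverts G) \<in> proper_colorings G (card (pverts G))"
    using g(1) by (auto simp: proper_colorings_eq colorings_on_def)
  then have "\<exists>m. proper_colorings G m \<noteq> {}" by blast
  then have "proper_colorings G (chromatic_number G) \<noteq> {}"
    unfolding chromatic_number_def by (rule LeastI_ex)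
  then obtain c where c: "c \<in> colorings_on (parcs G) (pverts G) (chromatic_number G)"
    by (auto simp: proper_colorings_eq)
  have "card K = card (c ` K)" using colorings_on_inj_on[OF c assms(2,1)] by (simp add: card_image)
  also have "\<dots> \<le> card {1..chromatic_number G}"
    using colorings_on_range[OF c] assms(1) by (intro card_mono) blast+
  finally show ?thesis by simp
qed

text \<open>Otherwise \<open>{a, b, c}\<close> would be independent with three elements. Later
  arguments use the independence number only in this form.\<close>

lemma no_independent_triple:
  assumes "independence_number G = 2" "a \<in> pverts G" "b \<in> pverts G" "c \<in> pverts G"
    and "a \<noteq> b" "b \<noteq> c" "a \<noteq> c"
  shows "(a, b) \<in> parcs G \<or> (b, c) \<in> parcs G \<or> (a, c) \<in> parcs G"
proof (rule ccontr)
  assume "\<not> ?thesis"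
  then have "independent_set G {a, b, c}"
    using assms E_sym E_irrefl unfolding independent_set_def by blast
  moreover have "card {a, b, c} = 3" using assms by simp
  moreover have "{card S |S. independent_set G S} \<subseteq> card ` Pow (pverts G)"
    by (auto simp: independent_set_def)
  then have "finite {card S |S. independent_set G S}"
    by (rule finite_subset) (simp add: pair_finite_verts)
  moreover from calculation have "3 \<in> {card S |S. independent_set G S}" by (metis (mono_tags, lifting) mem_Collect_eq)
  ultimately have "3 \<le> independence_number G"
    unfolding independence_number_def by (intro Max_ge)
  with assms(1) show False by simp
qed

section \<open>Connectivity and vertex cuts\<close>

lemma parcs_mk_symmetric_induce:
  "parcs (mk_symmetric (with_proj G \<restriction> W)) = {(a, b) \<in> parcs G. a \<in> W \<and> b \<in> W}"
  by (auto simp: parcs_mk_symmetric induce_subgraph_def dest: E_sym)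

lemma connected_induce_edge:
  assumes "Digraph_Component.connected (with_proj G \<restriction> W)" "A \<subseteq> W" "A \<noteq> {}" "A \<noteq> W"
  shows "\<exists>a\<in>A. \<exists>b\<in>W - A. (a, b) \<in> parcs G"
proof (rule ccontr)
  assume no: "\<not> ?thesis"
  obtain a b where ab: "a \<in> A" "b \<in> W" "b \<notin> A" using assms by blast
  then have "a \<rightarrow>\<^sup>*\<^bsub>mk_symmetric (with_proj G \<restriction> W)\<^esub> b"
    using assms(1,2) by (auto simp: Digraph_Component.connected_def strongly_connected_def)
  then have "(a, b) \<in> rtrancl_on W {(a, b) \<in> parcs G. a \<in> W \<and> b \<in> W}"
    by (simp add: reachable_def parcs_mk_symmetric_induce)
  \<comment> \<open>With no arc leaving \<open>A\<close>, membership in \<open>A\<close> propagates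
    along the walk from \<open>a\<close> to \<open>b\<close>.\<close>
  then have "a \<in> A \<longrightarrow> b \<in> A"
    by (induction rule: rtrancl_on.induct) (use no in auto)
  with ab show False by simp
qed

text \<open>The sides are the vertices reachable inside \<open>W\<close> from a suitable
  \<open>a\<close>, and the rest. The empty graph does not count as connected, hence
  \<open>W \<noteq> {}\<close>.\<close>

lemma not_connected_induce_separation:
  assumes "\<not> Digraph_Component.connected (with_proj G \<restriction> W)" "W \<noteq> {}"
  obtains A B where "A \<noteq> {}" "B \<noteq> {}" "A \<union> B = W" "A \<inter> B = {}"
    "\<And>a b. a \<in> A \<Longrightarrow> b \<in> B \<Longrightarrow> (a, b) \<notin> parcs G"
proof -
  let ?R = "rtrancl_on W {(a, b) \<in> parcs G. a \<in> W \<and> b \<in> W}"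
  obtain a b where ab: "a \<in> W" "b \<in> W" "(a, b) \<notin> ?R"
    using assms unfolding Digraph_Component.connected_def strongly_connected_def
    by (auto simp: reachable_def parcs_mk_symmetric_induce)
  show ?thesis
  proof (rule that[of "{c \<in> W. (a, c) \<in> ?R}" "{c \<in> W. (a, c) \<notin> ?R}"])
    show "(p, q) \<notin> parcs G" if "p \<in> {c \<in> W. (a, c) \<in> ?R}" "q \<in> {c \<in> W. (a, c) \<notin> ?R}" for p q
      using that by (auto intro: rtrancl_on_into_rtrancl_on)
  qed (use ab in auto)
qed

text \<open>At least two vertices survive the deletion of m when m + 1 < |V|, which excludes the
  second alternative in the definition of connectivity.\<close>

lemma vertex_cut_exists:
  assumes "vertex_connectivity G = m" "m + 1 < card (pverts G)"
  obtains S where "S \<subseteq> pverts G" "card S = m"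
    "\<not> Digraph_Component.connected (with_proj G \<restriction> (pverts G - S))"
proof -
  let ?P = "\<lambda>m. \<exists>S \<subseteq> pverts G. card S = m \<and>
        (\<not> Digraph_Component.connected (with_proj G \<restriction> (pverts G - S)) \<or>
         card (pverts G - S) \<le> 1)"
  have "?P (card (pverts G))" by (intro exI[of _ "pverts G"]) simp
  then have "\<exists>m. ?P m" by blast
  from LeastI_ex[OF this] assms(1) have "?P m" by (simp add: vertex_connectivity_def)
  then obtain S where S: "S \<subseteq> pverts G" "card S = m"
    "\<not> Digraph_Component.connected (with_proj G \<restriction> (pverts G - S)) \<or> card (pverts G - S) \<le> 1"
    by blast
  have "card (pverts G - S) = card (pverts G) - m"
    using S pair_finite_verts by (metis card_Diff_subset finite_subset)
  then show ?thesis using S assms(2) that by auto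
qed

end

section \<open>Isomorphisms and invariance of the chromatic polynomial\<close>

lemma graph_isoI:
  assumes "pair_graph G" "pair_graph H" "bij_betw f (pverts G) (pverts H)"
    and "\<And>u v. u \<in> pverts G \<Longrightarrow> v \<in> pverts G \<Longrightarrow> (u, v) \<in> parcs G \<longleftrightarrow> (f u, f v) \<in> parcs H"
  shows "G \<simeq>\<^sub>G H"
proof -
  interpret G: pair_graph G by fact
  interpret H: pair_graph H by fact
  \<comment> \<open>Arcs are pairs of endpoints, so the vertex map determines the arc map.\<close>
  let ?h = "\<lparr>iso_verts = f, iso_arcs = map_prod f f, iso_head = snd, iso_tail = fst\<rparr>"
  have inj: "inj_on f (pverts G)" and im: "f ` pverts G = pverts H"
    using assms(3) by (auto simp: bij_betw_def)
  have sub: "parcs G \<subseteq> pverts G \<times> pverts G" by (auto dest: G.in_arcsD1 G.in_arcsD2)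
  have "inj_on (map_prod f f) (parcs G)"
    by (rule inj_on_subset[OF map_prod_inj_on[OF inj inj] sub])
  then have "pre_digraph.digraph_isomorphism (with_proj G) ?h"
    using inj G.wf_digraph_axioms by (simp add: pre_digraph.digraph_isomorphism_def)
  moreover have "map_prod f f ` parcs G = parcs H"
  proof
    show "map_prod f f ` parcs G \<subseteq> parcs H" using assms(4) sub by auto
    show "parcs H \<subseteq> map_prod f f ` parcs G"
    proof
      fix e assume e: "e \<in> parcs H"
      then obtain p q where pq: "e = (f p, f q)" "p \<in> pverts G" "q \<in> pverts G"
        using im H.in_arcsD1 H.in_arcsD2 by (cases e) blast
      with e assms(4) have "(p, q) \<in> parcs G" by simp
      then show "e \<in> map_prod f f ` parcs G" using pq by (force simp: image_iff)
    qed
  qed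
  then have "with_proj H = app_iso ?h (with_proj G)"
    using im by (simp add: app_iso_def with_proj_def)
  ultimately show ?thesis unfolding graph_iso_def digraph_iso_def by blast
qed

lemma graph_isoE:
  assumes "G \<simeq>\<^sub>G H" "pair_graph G"
  obtains f where "bij_betw f (pverts G) (pverts H)" "parcs H = map_prod f f ` parcs G"
proof -
  obtain h where h: "pre_digraph.digraph_isomorphism (with_proj G) h"
    "with_proj H = app_iso h (with_proj G)"
    using assms(1) by (auto simp: graph_iso_def digraph_iso_def)
  from h(2) have H: "pverts H = iso_verts h ` pverts G" "parcs H = iso_arcs h ` parcs G"
    "iso_tail h = fst" "iso_head h = snd"
    by (auto simp: app_iso_def with_proj_def)
  \<comment> \<open>Tail and head are the projections in both graphs and are respected by
    \<open>h\<close>, so the arc map acts componentwise.\<close>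
  have "iso_arcs h e = map_prod (iso_verts h) (iso_verts h) e" if "e \<in> parcs G" for e
    using h(1) that H(3,4) by (cases e) (auto simp: pre_digraph.digraph_isomorphism_def prod_eq_iff)
  then have "parcs H = map_prod (iso_verts h) (iso_verts h) ` parcs G"
    using H(2) by (simp cong: image_cong)
  moreover have "bij_betw (iso_verts h) (pverts G) (pverts H)"
    using h(1) H(1) by (simp add: pre_digraph.digraph_isomorphism_def bij_betw_def)
  ultimately show ?thesis using that by blast
qed

lemma graph_iso_card: "G \<simeq>\<^sub>G H \<Longrightarrow> pair_graph G \<Longrightarrow> card (pverts G) = card (pverts H)"
  by (metis graph_isoE bij_betw_same_card)

lemma chromatic_poly_iso:
  assumes "G \<simeq>\<^sub>G H" "pair_graph G"
  shows "chromatic_poly G x = chromatic_poly H x"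
proof -
  interpret pair_graph G by fact
  obtain f where f: "bij_betw f (pverts G) (pverts H)" "parcs H = map_prod f f ` parcs G"
    using graph_isoE[OF assms] .
  let ?g = "the_inv_into (pverts G) f"
  have inj: "inj_on f (pverts G)" and im: "f ` pverts G = pverts H"
    using f(1) by (auto simp: bij_betw_def)
  have gf: "?g (f u) = u" if "u \<in> pverts G" for u
    using inj that by (rule the_inv_into_f_f)
  have fg: "f (?g w) = w" "?g w \<in> pverts G" if "w \<in> pverts H" for w
    using that im f_the_inv_into_f[OF inj] the_inv_into_into[OF inj _ subset_refl] by auto
  have "bij_betw (\<lambda>c. restrict (c \<circ> ?g) (pverts H)) (proper_colorings G x) (proper_colorings H x)"
  proof (rule bij_betwI[where g = "\<lambda>d. restrict (d \<circ> f) (pverts G)"])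
    show "(\<lambda>c. restrict (c \<circ> ?g) (pverts H)) \<in> proper_colorings G x \<rightarrow> proper_colorings H x"
    proof
      fix c assume c: "c \<in> proper_colorings G x"
      have "c (?g u) \<noteq> c (?g v)" "u \<in> pverts H" "v \<in> pverts H" if "(u, v) \<in> parcs H" for u v
      proof -
        from that f(2) obtain p q where pq: "(p, q) \<in> parcs G" "u = f p" "v = f q" by auto
        then have "p \<in> pverts G" "q \<in> pverts G" by (auto dest: in_arcsD1 in_arcsD2)
        then show "c (?g u) \<noteq> c (?g v)" "u \<in> pverts H" "v \<in> pverts H"
          using pq c gf im by (auto simp: proper_colorings_def)
      qed
      then show "restrict (c \<circ> ?g) (pverts H) \<in> proper_colorings H x"
        using c fg by (fastforce simp: proper_colorings_def)
    qed
    show "(\<lambda>d. restrict (d \<circ> f) (pverts G)) \<in> proper_colorings H x \<rightarrow> proper_colorings G x"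
    proof
      fix d assume d: "d \<in> proper_colorings H x"
      have "d (f u) \<noteq> d (f v)" "u \<in> pverts G" "v \<in> pverts G" if "(u, v) \<in> parcs G" for u v
      proof -
        have "(f u, f v) \<in> parcs H" using that f(2) by force
        then show "d (f u) \<noteq> d (f v)" using d by (auto simp: proper_colorings_def)
      qed (use that in \<open>auto dest: in_arcsD1 in_arcsD2\<close>)
      then show "restrict (d \<circ> f) (pverts G) \<in> proper_colorings G x"
        using d im by (fastforce simp: proper_colorings_def)
    qed
    show "restrict (restrict (c \<circ> ?g) (pverts H) \<circ> f) (pverts G) = c"
      if "c \<in> proper_colorings G x" for c
      using that gf im
      by (auto simp: proper_colorings_def PiE_def extensional_def fun_eq_iff restrict_def)
    show "restrict (restrict (d \<circ> f) (pverts G) \<circ> ?g) (pverts H) = d"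
      if "d \<in> proper_colorings H x" for d
      using that fg
      by (auto simp: proper_colorings_def PiE_def extensional_def fun_eq_iff restrict_def)
  qed
  then show ?thesis unfolding chromatic_poly_def by (rule bij_betw_same_card)
qed

section \<open>Cliques with an ear\<close>

text \<open>The value of the chromatic polynomial of \<open>G\<^sub>k\<^sub>+\<^sub>j\<^sub>,\<^sub>k\<close> at \<open>x\<close>: a \<open>k\<close>-clique and a
  cycle of length \<open>j + 2\<close> glued along an edge.\<close>

definition ear_bound :: "nat \<Rightarrow> nat \<Rightarrow> nat \<Rightarrow> int" where
  "ear_bound x k j = falling_fact (int x - 1) (k - 1) * ((int x - 1) ^ (j + 1) + (-1) ^ j)"

text \<open>\<open>M\<close> is the cycle factor divided by x, and (x)_k = x (x - 1)_(k-1) absorbs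
  that x. Thus \<open>M\<close> counts the extensions of a coloured clique to the ear.\<close>

lemma ear_bound_eq:
  assumes "k \<ge> 1" "int x * M = (int x - 1) ^ (j + 1) + (-1) ^ j"
  shows "ear_bound x k j = falling_fact (int x) k * M"
  unfolding ear_bound_def assms(2)[symmetric]
  using assms(1) falling_fact_Suc_left[of "int x" "k - 1"] by simp

lemma ear_bound_1: "k \<ge> 1 \<Longrightarrow> ear_bound x k 1 = falling_fact (int x) k * (int x - 2)"
  by (rule ear_bound_eq) (simp_all add: power2_eq_square algebra_simps)

lemma ear_bound_2:
  "k \<ge> 1 \<Longrightarrow> ear_bound x k 2 = falling_fact (int x) k * ((int x - 1) * (int x - 2) + 1)"
  by (rule ear_bound_eq) (simp_all add: eval_nat_numeral algebra_simps)

text \<open>With y = x - 1, the identity x (x - 2) = y^2 - 1 turns x (x - 2) y^(j-1) into y^(j+1) -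
  y^(j-1). As y^(j-1) > 1, this is below y^(j+1) + (-1)^j. For j = 1 the two sides would
  agree.\<close>

lemma ear_bound_greater:
  assumes "k \<ge> 1" "x \<ge> k" "x \<ge> 3" "j \<ge> 2"
  shows "falling_fact (int x) k * ((int x - 2) * (int x - 1) ^ (j - 1)) < ear_bound x k j"
proof -
  define y where "y = int x - 1"
  obtain i where i: "j = Suc (Suc i)" using assms(4) by (metis add_2_eq_Suc le_Suc_ex)
  have y: "y \<ge> 2" using assms by (simp add: y_def)
  have "1 < y ^ Suc i" using y by (intro one_less_power) auto
  moreover have "(-1 :: int) ^ j \<ge> -1" by (cases "even j") auto
  ultimately have "y ^ (j + 1) - y ^ Suc i < y ^ (j + 1) + (-1) ^ j" by linarith
  moreover have "int x * ((int x - 2) * y ^ Suc i) = y ^ (j + 1) - y ^ Suc i"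
    unfolding y_def i by (simp add: algebra_simps)
  ultimately have "int x * ((int x - 2) * y ^ (j - 1)) < y ^ (j + 1) + (-1) ^ j"
    by (simp add: i)
  moreover have "falling_fact (int x - 1) (k - 1) > 0"
    using assms by (intro falling_fact_pos) auto
  ultimately have "falling_fact (int x - 1) (k - 1) * (int x * ((int x - 2) * y ^ (j - 1)))
      < falling_fact (int x - 1) (k - 1) * (y ^ (j + 1) + (-1) ^ j)"
    by (intro mult_strict_left_mono)
  then show ?thesis
    using assms(1) falling_fact_Suc_left[of "int x" "k - 1"]
    by (simp add: ear_bound_def y_def mult_ac)
qed

text \<open>The x - 1 colours open to \<open>w\<close> include that of \<open>t\<close>. If
  \<open>w\<close> takes it, \<open>w'\<close> has x - 1 choices, otherwise x - 2; this accounts for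
  the extra 1.\<close>

lemma (in loopfree_sym_rel) card_colorings_clique_path:
  assumes K: "finite K" "clique_set E K" and st: "s \<in> K" "t \<in> K" "s \<noteq> t"
    and w: "w \<notin> K" "w' \<notin> K" "w \<noteq> w'"
    and N: "{v \<in> K. (w, v) \<in> E} = {s}" "{v \<in> K. (w', v) \<in> E} = {t}" "(w', w) \<in> E"
  shows "int (card (colorings_on E (insert w' (insert w K)) x)) =
    falling_fact (int x) (card K) * ((int x - 1) * (int x - 2) + 1)"
proof -
  have N': "{v \<in> insert w K. (w', v) \<in> E} = {w, t}" using N st by blast
  have "int (card (colorings_on E (insert w' (insert w K)) x)) =
    (\<Sum>d\<in>colorings_on E (insert w K) x. int x - int (card {d w, d t}))"
    using card_colorings_insert[of "insert w K" w' x] K w unfolding N' by simp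
  also have "\<dots> = (\<Sum>c\<in>colorings_on E K x. \<Sum>i\<in>available E K x c w. int x - int (card {i, c t}))"
    using sum_colorings_insert[OF K(1) w(1), of "\<lambda>d. int x - int (card {d w, d t})" x] st w(1)
    by (auto intro!: sum.cong)
  also have "\<dots> = (\<Sum>c\<in>colorings_on E K x. (int x - 1) * (int x - 2) + 1)"
  proof (rule sum.cong[OF refl])
    fix c assume c: "c \<in> colorings_on E K x"
    have "(s, t) \<in> E" using K st by (auto simp: clique_set_def)
    then have ne: "c s \<noteq> c t" using colorings_on_neq[OF c] st by blast
    have av: "available E K x c w = {1..x} - {c s}" unfolding available_def N by simp
    have ct: "c t \<in> available E K x c w" using av ne colorings_on_range[OF c st(2)] by auto
    have card: "int (card (available E K x c w)) = int x - 1"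
      using card_available[OF K(1) c, of w] unfolding N by simp
    have "(\<Sum>i\<in>available E K x c w. int x - int (card {i, c t})) =
      (\<Sum>i\<in>available E K x c w. int x - 2 + (if i = c t then 1 else 0))"
      by (rule sum.cong) auto
    also have "\<dots> = (int x - 1) * (int x - 2) + 1"
      using card ct by (simp add: sum.distrib)
    finally show "(\<Sum>i\<in>available E K x c w. int x - int (card {i, c t})) =
      (int x - 1) * (int x - 2) + 1" .
  qed
  also have "\<dots> = falling_fact (int x) (card K) * ((int x - 1) * (int x - 2) + 1)"
    by (simp add: card_colorings_clique[OF K])
  finally show ?thesis .
qed

section \<open>The two extremal graphs: polynomials and recognition\<close>

lemma clique_with_ear_1:
  "pverts (clique_with_ear (k + 1) k) = insert k {0..<k}"
  "parcs (clique_with_ear (k + 1) k) =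
     {(i, j). i < k \<and> j < k \<and> i \<noteq> j} \<union> {(0, k), (k, 1), (k, 0), (1, k)}"
  by (auto simp: clique_with_ear_def Let_def)

lemma clique_with_ear_2:
  "pverts (clique_with_ear (k + 2) k) = insert (k + 1) (insert k {0..<k})"
  "parcs (clique_with_ear (k + 2) k) =
     {(i, j). i < k \<and> j < k \<and> i \<noteq> j} \<union>
     {(0, k), (k, k + 1), (k + 1, 1), (k, 0), (k + 1, k), (1, k + 1)}"
  by (auto simp: clique_with_ear_def Let_def)

lemma pair_graph_clique_with_ear_1: "k \<ge> 2 \<Longrightarrow> pair_graph (clique_with_ear (k + 1) k)"
proof -
  assume k: "k \<ge> 2"
  let ?H = "clique_with_ear (k + 1) k"
  have sub: "fst e \<in> pverts ?H" "snd e \<in> pverts ?H" "fst e \<noteq> snd e" if "e \<in> parcs ?H" for e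
    using that k unfolding clique_with_ear_1 by auto
  have fin: "finite (pverts ?H)" unfolding clique_with_ear_1 by simp
  have "parcs ?H \<subseteq> pverts ?H \<times> pverts ?H" using sub by (auto simp: mem_Times_iff)
  then have "finite (parcs ?H)" using fin by (meson finite_SigmaI finite_subset)
  moreover have "sym (parcs ?H)" unfolding clique_with_ear_1 by (rule symI) auto
  ultimately show ?thesis
    using fin sub by unfold_locales (simp_all only: symmetric_def with_proj_simps not_False_eq_True)
qed

lemma pair_graph_clique_with_ear_2: "k \<ge> 2 \<Longrightarrow> pair_graph (clique_with_ear (k + 2) k)"
proof -
  assume k: "k \<ge> 2"
  let ?H = "clique_with_ear (k + 2) k"
  have sub: "fst e \<in> pverts ?H" "snd e \<in> pverts ?H" "fst e \<noteq> snd e" if "e \<in> parcs ?H" for e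
    using that k unfolding clique_with_ear_2 by auto
  have fin: "finite (pverts ?H)" unfolding clique_with_ear_2 by simp
  have "parcs ?H \<subseteq> pverts ?H \<times> pverts ?H" using sub by (auto simp: mem_Times_iff)
  then have "finite (parcs ?H)" using fin by (meson finite_SigmaI finite_subset)
  moreover have "sym (parcs ?H)" unfolding clique_with_ear_2 by (rule symI) auto
  ultimately show ?thesis
    using fin sub by unfold_locales (simp_all only: symmetric_def with_proj_simps not_False_eq_True)
qed

lemma chromatic_poly_clique_with_ear_1:
  assumes "k \<ge> 2"
  shows "int (chromatic_poly (clique_with_ear (k + 1) k) x) = ear_bound x k 1"
proof -
  let ?H = "clique_with_ear (k + 1) k"
  interpret H: pair_graph ?H using assms by (rule pair_graph_clique_with_ear_1)
  have cl: "clique_set (parcs ?H) {0..<k}"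
    unfolding clique_with_ear_1 clique_set_def by auto
  have N: "{v \<in> {0..<k}. (k, v) \<in> parcs ?H} = {0, 1}"
    using assms unfolding clique_with_ear_1 by auto
  have "clique_set (parcs ?H) {v \<in> {0..<k}. (k, v) \<in> parcs ?H}"
    using cl by (auto simp: clique_set_def)
  then show ?thesis
    using H.card_colorings_insert_clique_nbhd[of "{0..<k}" k x]
      H.card_colorings_clique[OF _ cl, of x] assms
    unfolding N chromatic_poly_def H.proper_colorings_eq clique_with_ear_1(1)
    by (simp add: ear_bound_1[simplified])
qed

lemma chromatic_poly_clique_with_ear_2:
  assumes "k \<ge> 2"
  shows "int (chromatic_poly (clique_with_ear (k + 2) k) x) = ear_bound x k 2"
proof -
  let ?H = "clique_with_ear (k + 2) k"
  interpret H: pair_graph ?H using assms by (rule pair_graph_clique_with_ear_2)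
  have cl: "clique_set (parcs ?H) {0..<k}"
    unfolding clique_with_ear_2 clique_set_def by auto
  have "{v \<in> {0..<k}. (k, v) \<in> parcs ?H} = {0}" "{v \<in> {0..<k}. (k + 1, v) \<in> parcs ?H} = {1}"
    "(k + 1, k) \<in> parcs ?H"
    using assms unfolding clique_with_ear_2 by auto
  from H.card_colorings_clique_path[OF _ cl _ _ _ _ _ _ this] show ?thesis
    using assms unfolding chromatic_poly_def H.proper_colorings_eq clique_with_ear_2(1)
    by (simp add: ear_bound_2)
qed

text \<open>The path of \<open>clique_with_ear\<close> is attached at 0 and 1, so the attachment
  vertices \<open>s\<close> and \<open>t\<close> must be sent there; the rest is numbered
  freely.\<close>

lemma exists_bij_betw_clique:
  assumes "finite K" "card K = k" "s \<in> K" "t \<in> K" "s \<noteq> t"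
  obtains g where "bij_betw g K {0..<k}" "g s = 0" "g t = (1::nat)"
proof -
  have "card (K - {s, t}) = card {2..<k}" using assms by (simp add: card_Diff_subset)
  then obtain g where g: "bij_betw g (K - {s, t}) {2..<k}"
    using finite_same_card_bij[of "K - {s, t}" "{2..<k}"] assms(1) by auto
  have k: "k \<ge> 2" using card_mono[OF assms(1), of "{s, t}"] assms by simp
  let ?g = "g(s := 0, t := 1)"
  have "bij_betw ?g (K - {s, t}) {2..<k}"
    using g by (subst bij_betw_cong[where g = g]) auto
  moreover have "bij_betw ?g {s, t} {0, 1}" using assms by (auto simp: bij_betw_def)
  ultimately have "bij_betw ?g ((K - {s, t}) \<union> {s, t}) ({2..<k} \<union> {0, 1})"
    by (rule bij_betw_combine) auto
  moreover have "(K - {s, t}) \<union> {s, t} = K" "{2..<k} \<union> {0, 1} = {0..<k}"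
    using assms k by auto
  ultimately show ?thesis using that[of ?g] assms by simp
qed

context pair_graph
begin

lemma iso_clique_with_ear_1:
  assumes K: "clique_set (parcs G) K" "card K = k" and V: "pverts G = insert w K" "w \<notin> K"
    and st: "s \<in> K" "t \<in> K" "s \<noteq> t" and N: "{v \<in> K. (w, v) \<in> parcs G} = {s, t}"
  shows "G \<simeq>\<^sub>G clique_with_ear (k + 1) k"
proof -
  have fin: "finite K" using V pair_finite_verts by simp
  obtain g where g: "bij_betw g K {0..<k}" "g s = 0" "g t = 1"
    using exists_bij_betw_clique[OF fin K(2) st] .
  let ?f = "g(w := k)"
  have k: "k \<ge> 2" using card_mono[OF fin, of "{s, t}"] st K(2) by simp
  have lt: "g u < k" if "u \<in> K" for u using g(1) that by (auto simp: bij_betw_def)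
  have inj: "g u = g v \<longleftrightarrow> u = v" if "u \<in> K" "v \<in> K" for u v
    using g(1) that by (auto simp: bij_betw_def inj_on_eq_iff)
  have "bij_betw ?f K {0..<k}"
    using g(1) V(2) by (subst bij_betw_cong[where g = g]) auto
  then have bij: "bij_betw ?f (pverts G) (insert k {0..<k})"
    using V notIn_Un_bij_betw3[of w K ?f "{0..<k}"] by simp
  have KK: "(u, v) \<in> parcs G \<longleftrightarrow> g u \<noteq> g v" if "u \<in> K" "v \<in> K" for u v
    using that K(1) inj E_irrefl by (auto simp: clique_set_def)
  have wK: "(w, v) \<in> parcs G \<longleftrightarrow> g v = 0 \<or> g v = 1" if "v \<in> K" for v
    using N inj[OF that st(1)] inj[OF that st(2)] g(2,3) that by auto
  then have Kw: "(v, w) \<in> parcs G \<longleftrightarrow> g v = 0 \<or> g v = 1" if "v \<in> K" for v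
    using that E_sym by metis
  show ?thesis
  proof (rule graph_isoI[OF pair_graph_axioms pair_graph_clique_with_ear_1[OF k]])
    show "bij_betw ?f (pverts G) (pverts (clique_with_ear (k + 1) k))"
      using bij unfolding clique_with_ear_1 .
    fix u v assume "u \<in> pverts G" "v \<in> pverts G"
    then consider "u \<in> K" "v \<in> K" | "u = w" "v \<in> K" | "u \<in> K" "v = w" | "u = w" "v = w"
      using V by blast
    then show "(u, v) \<in> parcs G \<longleftrightarrow> (?f u, ?f v) \<in> parcs (clique_with_ear (k + 1) k)"
    proof cases
      case 1 then show ?thesis unfolding clique_with_ear_1 using KK[OF 1] lt[of u] lt[of v] V(2) by auto
    next
      case 2 then show ?thesis unfolding clique_with_ear_1 using wK[of v] lt[of v] V(2) k by auto
    next
      case 3 then show ?thesis unfolding clique_with_ear_1 using Kw[of u] lt[of u] V(2) k by auto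
    next
      case 4 then show ?thesis unfolding clique_with_ear_1 using E_irrefl k by auto
    qed
  qed
qed

lemma iso_clique_with_ear_2:
  assumes K: "clique_set (parcs G) K" "card K = k"
    and V: "pverts G = insert w' (insert w K)" "w \<notin> K" "w' \<notin> K" "w \<noteq> w'"
    and st: "s \<in> K" "t \<in> K" "s \<noteq> t"
    and N: "{v \<in> K. (w, v) \<in> parcs G} = {s}" "{v \<in> K. (w', v) \<in> parcs G} = {t}" "(w', w) \<in> parcs G"
  shows "G \<simeq>\<^sub>G clique_with_ear (k + 2) k"
proof -
  have fin: "finite K" using V pair_finite_verts by simp
  obtain g where g: "bij_betw g K {0..<k}" "g s = 0" "g t = 1"
    using exists_bij_betw_clique[OF fin K(2) st] .
  let ?f = "g(w := k, w' := k + 1)"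
  have k: "k \<ge> 2" using card_mono[OF fin, of "{s, t}"] st K(2) by simp
  have lt: "g u < k" if "u \<in> K" for u using g(1) that by (auto simp: bij_betw_def)
  have inj: "g u = g v \<longleftrightarrow> u = v" if "u \<in> K" "v \<in> K" for u v
    using g(1) that by (auto simp: bij_betw_def inj_on_eq_iff)
  have "bij_betw ?f K {0..<k}"
    using g(1) V(2,3) by (subst bij_betw_cong[where g = g]) auto
  then have "bij_betw ?f (insert w K) (insert k {0..<k})"
    using V notIn_Un_bij_betw3[of w K ?f "{0..<k}"] by simp
  then have bij: "bij_betw ?f (pverts G) (insert (k + 1) (insert k {0..<k}))"
    using V notIn_Un_bij_betw3[of w' "insert w K" ?f "insert k {0..<k}"] by simp
  have KK: "(u, v) \<in> parcs G \<longleftrightarrow> g u \<noteq> g v" if "u \<in> K" "v \<in> K" for u v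
    using that K(1) inj E_irrefl by (auto simp: clique_set_def)
  have wK: "(w, v) \<in> parcs G \<longleftrightarrow> g v = 0" "(w', v) \<in> parcs G \<longleftrightarrow> g v = 1" if "v \<in> K" for v
    using N inj[OF that st(1)] inj[OF that st(2)] g(2,3) that by auto
  then have Kw: "(v, w) \<in> parcs G \<longleftrightarrow> g v = 0" "(v, w') \<in> parcs G \<longleftrightarrow> g v = 1"
    if "v \<in> K" for v using that E_sym by metis+
  show ?thesis
  proof (rule graph_isoI[OF pair_graph_axioms pair_graph_clique_with_ear_2[OF k]])
    show "bij_betw ?f (pverts G) (pverts (clique_with_ear (k + 2) k))"
      using bij unfolding clique_with_ear_2 .
    fix u v assume "u \<in> pverts G" "v \<in> pverts G"
    then have "u \<in> K \<or> u = w \<or> u = w'" "v \<in> K \<or> v = w \<or> v = w'" using V by auto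
    then consider "u \<in> K" "v \<in> K" | "u = w" "v \<in> K" | "u \<in> K" "v = w"
      | "u = w'" "v \<in> K" | "u \<in> K" "v = w'" | "u = w" "v = w'" | "u = w'" "v = w"
      | "u = v" "v = w \<or> v = w'"
      by metis
    then show "(u, v) \<in> parcs G \<longleftrightarrow> (?f u, ?f v) \<in> parcs (clique_with_ear (k + 2) k)"
    proof cases
      case 1
      then have "u \<noteq> w" "u \<noteq> w'" "v \<noteq> w" "v \<noteq> w'" using V by auto
      then show ?thesis unfolding clique_with_ear_2 using KK[OF 1] lt[OF 1(1)] lt[OF 1(2)] by auto
    next
      case 2
      then have "v \<noteq> w" "v \<noteq> w'" using V by auto
      then show ?thesis unfolding clique_with_ear_2 using 2(1) wK[OF 2(2)] lt[OF 2(2)] V(4) k by auto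
    next
      case 3
      then have "u \<noteq> w" "u \<noteq> w'" using V by auto
      then show ?thesis unfolding clique_with_ear_2 using 3(2) Kw[OF 3(1)] lt[OF 3(1)] V(4) k by auto
    next
      case 4
      then have "v \<noteq> w" "v \<noteq> w'" using V by auto
      then show ?thesis unfolding clique_with_ear_2 using 4(1) wK[OF 4(2)] lt[OF 4(2)] V(4) k by auto
    next
      case 5
      then have "u \<noteq> w" "u \<noteq> w'" using V by auto
      then show ?thesis unfolding clique_with_ear_2 using 5(2) Kw[OF 5(1)] lt[OF 5(1)] V(4) k by auto
    next
      case 6 then show ?thesis unfolding clique_with_ear_2 using V(4) E_sym[OF N(3)] by auto
    next
      case 7 then show ?thesis unfolding clique_with_ear_2 using V(4) N(3) by auto
    next
      case 8 then show ?thesis unfolding clique_with_ear_2 using E_irrefl k by auto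
    qed
  qed
qed

text \<open>Colour the rest along a search order from \<open>W\<close>: each new vertex has a coloured neighbour.\<close>

lemma card_colorings_connected_le:
  assumes "Digraph_Component.connected (with_proj G \<restriction> pverts G)"
    and "W \<subseteq> pverts G" "W \<noteq> {}" "x \<ge> 1"
  shows "int (card (colorings_on (parcs G) (pverts G) x)) \<le>
    int (card (colorings_on (parcs G) W x)) * (int x - 1) ^ (card (pverts G) - card W)"
  using assms(2,3)
proof (induction "card (pverts G) - card W" arbitrary: W)
  case 0
  then have "W = pverts G" using card_seteq[OF pair_finite_verts, of W] by simp
  then show ?case by simp
next
  case (Suc m)
  have fin: "finite W" using Suc.prems pair_finite_verts by (auto intro: finite_subset)
  have "W \<noteq> pverts G" using Suc.hyps by auto
  then obtain a w where w: "a \<in> W" "w \<in> pverts G" "w \<notin> W" "(a, w) \<in> parcs G"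
    using connected_induce_edge[OF assms(1) Suc.prems] by blast
  have m: "m = card (pverts G) - card (insert w W)" using Suc.hyps w fin by simp
  have "int (card (colorings_on (parcs G) (pverts G) x)) \<le>
    int (card (colorings_on (parcs G) (insert w W) x)) * (int x - 1) ^ m"
    using Suc.hyps(1)[OF m] Suc.prems w m by simp
  also have "\<dots> \<le> int (card (colorings_on (parcs G) W x)) * (int x - 1) * (int x - 1) ^ m"
    using card_colorings_insert_le[OF fin w(3), of "{a}" x] w E_sym assms(4)
    by (intro mult_right_mono) (auto simp: clique_set_def)
  finally show ?case by (simp add: Suc.hyps(2)[symmetric] mult_ac)
qed

end

section \<open>Graphs with a maximum clique, and the exceptional family\<close>

context pair_graph
begin

lemma clique_iso_or_less:
  assumes conn: "k_connected 2 G" and ind: "independence_number G = 2"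
    and K: "K \<subseteq> pverts G" "clique_set (parcs G) K" "card K = k"
    and k: "k \<ge> 3" "k < card (pverts G)" "x \<ge> k"
  shows "G \<simeq>\<^sub>G clique_with_ear (k + 1) k \<or> G \<simeq>\<^sub>G clique_with_ear (k + 2) k \<or>
    int (chromatic_poly G x) < ear_bound x k (card (pverts G) - k)"
proof -
  let ?E = "parcs G" and ?V = "pverts G" and ?j = "card (pverts G) - k"
  define P where "P W = int (card (colorings_on (parcs G) W x))" for W
  have poly: "int (chromatic_poly G x) = P ?V"
    by (simp add: chromatic_poly_def proper_colorings_eq P_def)
  have fin: "finite K" using K(1) pair_finite_verts by (rule finite_subset)
  have con0: "Digraph_Component.connected (with_proj G \<restriction> ?V)"
    using conn[unfolded k_connected_def, THEN conjunct2, rule_format, of "{}"] by simp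
  have con1: "Digraph_Component.connected (with_proj G \<restriction> (?V - {z}))" if "z \<in> ?V" for z
    using conn[unfolded k_connected_def, THEN conjunct2, rule_format, of "{z}"] that by simp
  have PK: "P K = falling_fact (int x) k"
    unfolding P_def using card_colorings_clique[OF fin K(2)] K(3) by simp
  have ff: "falling_fact (int x) k > 0" using k by (intro falling_fact_pos) simp
  have x: "x \<ge> 3" using k by simp
  have greedy: "P ?V \<le> P W * (int x - 1) ^ (card ?V - card W)" if "W \<subseteq> ?V" "W \<noteq> {}" for W
    unfolding P_def using card_colorings_connected_le[OF con0 that, of x] x by simp
  \<comment> \<open>When at least two vertices lie outside \<open>K\<close>, it suffices that one of
    them has at most x - 2 choices and the others at most x - 1.\<close>
  have strict: "P ?V < ear_bound x k ?j"
    if "P ?V \<le> falling_fact (int x) k * ((int x - 2) * (int x - 1) ^ (?j - 1))" "?j \<ge> 2"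
    using that(1) ear_bound_greater[of k x ?j] that(2) k by simp
  show ?thesis
  proof (cases "\<exists>w\<in>?V - K. \<exists>s\<in>K. \<exists>t\<in>K. s \<noteq> t \<and> (w, s) \<in> ?E \<and> (w, t) \<in> ?E")
    case True
    then obtain w s t where w: "w \<in> ?V" "w \<notin> K" and st: "s \<in> K" "t \<in> K" "s \<noteq> t"
      and ws: "(w, s) \<in> ?E" "(w, t) \<in> ?E" by blast
    let ?N = "{a \<in> K. (w, a) \<in> ?E}"
    have card_wK: "card (insert w K) = k + 1" using fin w K(3) by simp
    have clN: "clique_set ?E ?N" using K(2) by (auto simp: clique_set_def)
    \<comment> \<open>The neighbours of \<open>w\<close> in \<open>K\<close> form a clique, so this
      count is exact; for j = 1 it is the whole polynomial.\<close>
    have PwK: "P (insert w K) = falling_fact (int x) k * (int x - int (card ?N))"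
      using card_colorings_insert_clique_nbhd[OF fin w(2) clN] PK by (simp add: P_def)
    have sub: "{s, t} \<subseteq> ?N" using st ws by auto
    have finN: "finite ?N" using fin by simp
    have N2: "card ?N \<ge> 2" using card_mono[OF finN sub] st by simp
    show ?thesis
    proof (cases "?j = 1")
      case True
      have V: "?V = insert w K"
        using card_subset_eq[OF pair_finite_verts, of "insert w K"] card_wK True w K(1) k by simp
      show ?thesis
      proof (cases "card ?N = 2")
        case True
        then have "?N = {s, t}" using card_subset_eq[OF finN sub] st by simp
        from iso_clique_with_ear_1[OF K(2,3) V w(2) st this] show ?thesis by blast
      next
        case False
        then have "int x - int (card ?N) < int x - 2" using N2 by simp
        then have "P ?V < ear_bound x k 1"
          unfolding V PwK using k ff by (subst ear_bound_1) auto
        then show ?thesis using True poly by simp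
      qed
    next
      case False
      then have j: "?j \<ge> 2" using k by simp
      have "P ?V \<le> P (insert w K) * (int x - 1) ^ (?j - 1)"
        using greedy[of "insert w K"] w K card_wK by simp
      also have "\<dots> \<le> (falling_fact (int x) k * (int x - 2)) * (int x - 1) ^ (?j - 1)"
        unfolding PwK using N2 x ff by (intro mult_right_mono mult_left_mono) auto
      finally show ?thesis using strict[OF _ j] poly by (simp add: mult_ac)
    qed
  next
    case False
    then have one: "s = t"
      if "w \<in> ?V" "w \<notin> K" "s \<in> K" "t \<in> K" "(w, s) \<in> ?E" "(w, t) \<in> ?E" for w s t
      using that by blast
    \<comment> \<open>Each outside vertex has at most one neighbour in \<open>K\<close>, so two of
      them miss a common vertex of \<open>K\<close> because k >= 3. If nonadjacent, they would form
      an independent triple with it.\<close>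
    have R: "(p, q) \<in> ?E" if pq: "p \<in> ?V" "p \<notin> K" "q \<in> ?V" "q \<notin> K" "p \<noteq> q" for p q
    proof (rule ccontr)
      assume no: "(p, q) \<notin> ?E"
      have le1: "card {a \<in> K. (w, a) \<in> ?E} \<le> 1" if w: "w \<in> ?V" "w \<notin> K" for w
      proof -
        have "\<forall>s\<in>{a \<in> K. (w, a) \<in> ?E}. \<forall>t\<in>{a \<in> K. (w, a) \<in> ?E}. s = t"
          using one[OF w] by simp
        then show ?thesis using fin by (simp add: card_le_Suc0_iff_eq)
      qed
      let ?U = "{a \<in> K. (p, a) \<in> ?E} \<union> {a \<in> K. (q, a) \<in> ?E}"
      have "card ?U < card K"
        using card_Un_le[of "{a \<in> K. (p, a) \<in> ?E}" "{a \<in> K. (q, a) \<in> ?E}"]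
          le1[OF pq(1,2)] le1[OF pq(3,4)] K(3) k by linarith
      then have "?U \<noteq> K" by force
      then obtain a where a: "a \<in> K" "(p, a) \<notin> ?E" "(q, a) \<notin> ?E" by blast
      then show False
        using no_independent_triple[OF ind, of p q a] pq no K(1) by blast
    qed
    have "K \<noteq> {}" "K \<noteq> ?V" using K(3) k by auto
    then obtain s w where sw: "s \<in> K" "w \<in> ?V" "w \<notin> K" "(s, w) \<in> ?E"
      using connected_induce_edge[OF con0 K(1)] by blast
    \<comment> \<open>Deleting \<open>s\<close> leaves the graph connected, so an arc leaves
      \<open>K\<close> from another vertex \<open>t\<close>. It ends outside at a vertex other than
      \<open>w\<close>, which has only one neighbour in \<open>K\<close>.\<close>
    have "K - {s} \<noteq> {}"
    proof
      assume "K - {s} = {}"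
      then have "card K \<le> card {s}" by (intro card_mono) auto
      then show False using K(3) k by simp
    qed
    then obtain t w' where tw: "t \<in> K" "t \<noteq> s" "w' \<in> ?V" "w' \<notin> K" "(t, w') \<in> ?E"
      using connected_induce_edge[OF con1[of s], of "K - {s}"] sw K(1) by blast
    have ww: "w \<noteq> w'" using one[of w s t] sw tw E_sym by blast
    have adj: "(w', w) \<in> ?E" using R sw tw ww by blast
    let ?W = "insert w' (insert w K)"
    have card_W: "card ?W = k + 2" using fin sw tw ww K(3) by simp
    have W: "?W \<subseteq> ?V" using sw tw K(1) by blast
    show ?thesis
    proof (cases "?V = ?W")
      case True
      have "{a \<in> K. (w, a) \<in> ?E} = {s}" "{a \<in> K. (w', a) \<in> ?E} = {t}"
        using one[of w] one[of w'] sw tw E_sym by blast+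
      from iso_clique_with_ear_2[OF K(2,3) True sw(3) tw(4) ww sw(1) tw(1) tw(2)[symmetric] this adj]
      show ?thesis by blast
    next
      case False
      \<comment> \<open>The outside is a clique, so a third outside vertex \<open>r\<close> closes a
        triangle with \<open>w\<close> and \<open>w'\<close>: the factors are x - 1, x - 1 and x -
        2.\<close>
      then obtain r where r: "r \<in> ?V" "r \<notin> ?W" using W by blast
      have card_r: "card (insert r ?W) = k + 3" using r fin card_W by simp
      have j: "?j \<ge> 3"
        using card_mono[OF pair_finite_verts, of "insert r ?W"] r W card_r by simp
      have "P (insert w K) \<le> P K * (int x - 1)"
        using card_colorings_insert_le[OF fin sw(3), of "{s}" x] sw E_sym
        by (simp add: P_def clique_set_def)
      then have "P (insert w K) * (int x - 1) \<le> P K * (int x - 1) * (int x - 1)"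
        using x by (intro mult_right_mono) auto
      moreover have "P ?W \<le> P (insert w K) * (int x - 1)"
        using card_colorings_insert_le[of "insert w K" w' "{w}" x] fin tw ww adj
        by (simp add: P_def clique_set_def)
      ultimately have "P ?W \<le> P K * (int x - 1) * (int x - 1)" by linarith
      then have "P ?W * (int x - 2) \<le> P K * (int x - 1) * (int x - 1) * (int x - 2)"
        using x by (intro mult_right_mono) auto
      moreover have "P (insert r ?W) \<le> P ?W * (int x - 2)"
      proof -
        have "(r, w) \<in> ?E" "(r, w') \<in> ?E" using R r sw tw by blast+
        then have nbrs: "\<And>a. a \<in> {w, w'} \<Longrightarrow> (r, a) \<in> ?E" by blast
        have "clique_set ?E {w, w'}" using adj E_sym[OF adj] by (auto simp: clique_set_def)
        from card_colorings_insert_le[OF _ r(2) _ this nbrs, of x] show ?thesis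
          using fin ww by (simp add: P_def)
      qed
      ultimately have Pr: "P (insert r ?W) \<le> P K * (int x - 1) * (int x - 1) * (int x - 2)"
        by linarith
      have "P ?V \<le> P (insert r ?W) * (int x - 1) ^ (?j - 3)"
        using greedy[of "insert r ?W"] r W card_r by simp
      also have "\<dots> \<le> P K * (int x - 1) * (int x - 1) * (int x - 2) * (int x - 1) ^ (?j - 3)"
        using Pr x by (intro mult_right_mono) auto
      also have "\<dots> = P K * ((int x - 2) * (int x - 1) ^ (?j - 1))"
      proof -
        have "?j - 1 = Suc (Suc (?j - 3))" using j by simp
        then show ?thesis by (simp only: power_Suc) (simp add: mult_ac)
      qed
      finally show ?thesis using strict PK j poly by simp
    qed
  qed
qed

text \<open>The polynomial is computed by colouring \<open>A\<close>, then \<open>u\<close> and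
  \<open>v\<close>, then \<open>B\<close>. The last stage has (x - 1)_(k-2) extensions if
  \<open>u\<close> and \<open>v\<close> share a colour and (x - 2)_(k-2) otherwise. Every vertex of
  \<open>A\<close> is adjacent to \<open>u\<close> or \<open>v\<close>, so a shared colour avoids
  all k - 1 colours of \<open>A\<close>.\<close>

lemma exceptional_less:
  assumes V: "pverts G = A \<union> B \<union> {u, v}" "A \<inter> B = {}" "u \<notin> A \<union> B" "v \<notin> A \<union> B" "u \<noteq> v"
    and cl: "clique_set (parcs G) A" "clique_set (parcs G) B"
    and sep: "\<And>a b. a \<in> A \<Longrightarrow> b \<in> B \<Longrightarrow> (a, b) \<notin> parcs G"
    and uv: "(u, v) \<notin> parcs G"
    and B: "\<And>b. b \<in> B \<Longrightarrow> (u, b) \<in> parcs G \<and> (v, b) \<in> parcs G"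
    and A: "\<And>a. a \<in> A \<Longrightarrow> (u, a) \<in> parcs G \<or> (v, a) \<in> parcs G"
    and ne: "\<exists>a\<in>A. (u, a) \<in> parcs G" "\<exists>a\<in>A. (v, a) \<in> parcs G"
    and card: "card A = k - 1" "card B = k - 2" and k: "k \<ge> 4" "x \<ge> k"
  shows "int (chromatic_poly G x) < ear_bound x k (card (pverts G) - k)"
proof -
  let ?E = "parcs G"
  define y where "y = int x - 1"
  define Nu where "Nu = {a \<in> A. (u, a) \<in> ?E}"
  define Nv where "Nv = {a \<in> A. (v, a) \<in> ?E}"
  define du where "du = int (card Nu)"
  define dv where "dv = int (card Nv)"
  have y: "y \<ge> int k - 1" "y \<ge> 3" using k by (auto simp: y_def)
  have fin: "finite A" "finite B" using V(1) pair_finite_verts by simp_all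
  have finN: "finite Nu" "finite Nv" using fin by (simp_all add: Nu_def Nv_def)
  have un: "Nu \<union> Nv = A" using A by (auto simp: Nu_def Nv_def)
  have d1: "du \<ge> 1" "dv \<ge> 1"
    using ne finN by (auto simp: du_def dv_def Nu_def Nv_def Suc_le_eq card_gt_0_iff)
  have dle: "du \<le> int k - 1"
    using card_mono[OF fin(1), of Nu] card k by (auto simp: du_def Nu_def)
  have dsum: "du + dv \<ge> int k - 1"
    using card_Un_le[of Nu Nv] un card k by (simp add: du_def dv_def)
  define h1 where "h1 = falling_fact y (k - 2)"
  define h2 where "h2 = falling_fact (y - 1) (k - 2)"
  \<comment> \<open>\<open>h1\<close> and \<open>h2\<close> share the factor \<open>q\<close>. The
    other factor of \<open>h2\<close> is y - k + 2 = x - k + 1, also the number of colours that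
    \<open>u\<close> and \<open>v\<close> can share; taking it out completes (x)_(k-1) to
    (x)_k.\<close>
  define q where "q = falling_fact (y - 1) (k - 3)"
  have k2: "k - 2 = Suc (k - 3)" using k by simp
  have h1: "h1 = y * q" unfolding h1_def q_def k2 by (rule falling_fact_Suc_left)
  have h2: "h2 = q * (y - int k + 2)"
    unfolding h2_def q_def k2 falling_fact_Suc using k by simp
  let ?W = "insert v (insert u A)"
  have NB: "{a \<in> ?W. (b, a) \<in> ?E} = {u, v}" if "b \<in> B" for b
    using that B sep E_sym by blast
  have "int (chromatic_poly G x) = (\<Sum>d\<in>colorings_on ?E (?W \<union> B) x. 1)"
    using V(1) by (simp add: chromatic_poly_def proper_colorings_eq insert_commute Un_ac)
  also have "\<dots> = (\<Sum>c\<in>colorings_on ?E ?W x. falling_fact (int x - int (card {c u, c v})) (card B))"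
    using sum_colorings_join_clique[of ?W B u v "\<lambda>_ _. 1" x] fin V cl NB by simp
  also have "\<dots> = (\<Sum>c\<in>colorings_on ?E ?W x. if c u = c v then h1 else h2)"
    by (rule sum.cong) (auto simp: card h1_def h2_def y_def)
  also have "\<dots> = (\<Sum>d\<in>colorings_on ?E (insert u A) x. \<Sum>i\<in>available ?E (insert u A) x d v.
      if d u = i then h1 else h2)"
    using sum_colorings_insert[of "insert u A" v "\<lambda>c. if c u = c v then h1 else h2" x] fin V
    by simp
  also have "\<dots> = (\<Sum>d\<in>colorings_on ?E (insert u A) x. \<Sum>i\<in>{1..x} - d ` Nv.
      if d u = i then h1 else h2)"
  proof -
    have "{a \<in> insert u A. (v, a) \<in> ?E} = Nv" using uv E_sym by (auto simp: Nv_def)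
    then show ?thesis by (simp add: available_def)
  qed
  also have "\<dots> = (\<Sum>c\<in>colorings_on ?E A x. \<Sum>m\<in>{1..x} - c ` Nu. \<Sum>i\<in>{1..x} - c ` Nv.
      if m = i then h1 else h2)"
  proof -
    have im: "(c(u := m)) ` Nv = c ` Nv" for c m
      using V(3) by (auto simp: Nv_def intro!: image_cong)
    show ?thesis
      using sum_colorings_insert[of A u "\<lambda>d. \<Sum>i\<in>{1..x} - d ` Nv. if d u = i then h1 else h2" x]
        fin V(3) unfolding im by (simp add: available_def Nu_def)
  qed
  also have "\<dots> = (\<Sum>c\<in>colorings_on ?E A x. (int x - int k + 1) * h1 +
      ((int x - du) * (int x - dv) - (int x - int k + 1)) * h2)"
  proof (rule sum.cong[OF refl])
    fix c assume c: "c \<in> colorings_on ?E A x"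
    have cnt: "int (card ({1..x} - c ` N)) = int x - int (card N)" if "N \<subseteq> A" for N
    proof -
      have "inj_on c N" using colorings_on_inj_on[OF c cl(1)] that inj_on_subset by blast
      moreover have sub: "c ` N \<subseteq> {1..x}" using colorings_on_range[OF c] that by blast
      moreover from this have "card (c ` N) \<le> x" using card_mono[of "{1..x}"] by fastforce
      ultimately show ?thesis
        by (simp add: card_Diff_subset finite_subset[OF sub] card_image)
    qed
    let ?I = "{1..x} - c ` Nu" and ?J = "{1..x} - c ` Nv"
    have I: "int (card ?I) = int x - du" and J: "int (card ?J) = int x - dv"
      unfolding du_def dv_def by (rule cnt, force simp: Nu_def Nv_def)+
    have "?I \<inter> ?J = {1..x} - c ` A" using un by blast
    then have IJ: "int (card (?I \<inter> ?J)) = int x - int k + 1"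
      using cnt[of A] card k by simp
    \<comment> \<open>Every pair of colours for \<open>u\<close> and \<open>v\<close> gets weight
      \<open>h2\<close>; the diagonal, indexed by the common free colours, is then
      corrected.\<close>
    have "(\<Sum>m\<in>?I. \<Sum>i\<in>?J. if m = i then h1 else h2) =
      (\<Sum>m\<in>?I. \<Sum>i\<in>?J. h2 + (if m = i then h1 - h2 else 0))"
      by (intro sum.cong) auto
    also have "\<dots> = (\<Sum>m\<in>?I. (int x - dv) * h2 + (if m \<in> ?J then h1 - h2 else 0))"
      using J by (simp add: sum.distrib)
    also have "\<dots> = (int x - du) * ((int x - dv) * h2) + (\<Sum>m\<in>?I \<inter> ?J. h1 - h2)"
      using I by (subst sum.inter_restrict) (simp_all add: sum.distrib)
    also have "\<dots> = (int x - du) * ((int x - dv) * h2) + (int x - int k + 1) * (h1 - h2)"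
      using IJ by simp
    finally show "(\<Sum>m\<in>?I. \<Sum>i\<in>?J. if m = i then h1 else h2) = (int x - int k + 1) * h1 +
      ((int x - du) * (int x - dv) - (int x - int k + 1)) * h2"
      by (simp add: algebra_simps)
  qed
  also have "\<dots> = falling_fact (int x) (k - 1) * ((int x - int k + 1) * h1 +
      ((int x - du) * (int x - dv) - (int x - int k + 1)) * h2)"
    using card_colorings_clique[OF fin(1) cl(1), of x] card by simp
  also have "\<dots> = falling_fact (int x) k *
      (q * ((int x - du) * (int x - dv) + int k - 2))"
  proof -
    have ff: "falling_fact (int x) k = falling_fact (int x) (k - 1) * (int x - int k + 1)"
      using falling_fact_Suc[of "int x" "k - 1"] k by simp
    show ?thesis unfolding ff h1 h2 y_def by (simp add: algebra_simps)
  qed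
  also have "\<dots> < falling_fact (int x) k * ((int x - 2) * (int x - 1) ^ (k - 2))"
  proof -
    have "(y + 1 - du) * (y + 1 - dv) + int k - 2 < y * y"
    proof -
      \<comment> \<open>The product becomes (y - p)(y - r) = y^2 - (p y + r (y - p)), so it remains
        to show that the subtracted term exceeds k - 2.\<close>
      define p where "p = du - 1"
      define r where "r = dv - 1"
      have pr: "p \<ge> 0" "r \<ge> 0" "p + r \<ge> int k - 3" "p \<le> y"
        using d1 dsum dle y by (auto simp: p_def r_def)
      have "p * y + r * (y - p) > int k - 2"
      proof (cases "p = 0")
        case True
        then have "r \<ge> 1" using pr k by simp
        then have "r * y \<ge> 1 * y" using y by (intro mult_right_mono) auto
        then have "r * y > int k - 2" using y by linarith
        then show ?thesis using True by simp
      next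
        case False
        then have "p \<ge> 1" using pr by simp
        then have "p * y \<ge> 1 * y" using y by (intro mult_right_mono) auto
        moreover have "r * (y - p) \<ge> 0" using pr by simp
        ultimately show ?thesis using y by linarith
      qed
      then show ?thesis by (simp add: p_def r_def algebra_simps)
    qed
    then have "(int x - du) * (int x - dv) + int k - 2 < y ^ 2"
      by (simp add: y_def power2_eq_square)
    moreover have "q > 0" unfolding q_def using y k by (intro falling_fact_pos) linarith
    ultimately have "q * ((int x - du) * (int x - dv) + int k - 2) < q * y ^ 2" by simp
    \<comment> \<open>The first factor y - 1 of \<open>q\<close> is kept, since it supplies the x -
      2 of \<open>ear_bound_greater\<close>; the other k - 4 factors are bounded by y.\<close>
    also have "q \<le> (y - 1) * y ^ (k - 4)"
    proof -
      have k3: "k - 3 = Suc (k - 4)" using k by simp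
      have "falling_fact (y - 2) (k - 4) \<le> (y - 2) ^ (k - 4)"
        using y k by (intro falling_fact_le_power) linarith
      also have "\<dots> \<le> y ^ (k - 4)" using y by (intro power_mono) auto
      finally show ?thesis
        unfolding q_def k3 falling_fact_Suc_left using y by (simp add: mult_left_mono)
    qed
    then have "q * y ^ 2 \<le> (y - 1) * y ^ (k - 4) * y ^ 2" by (rule mult_right_mono) simp
    also have "\<dots> = (y - 1) * y ^ (k - 2)"
    proof -
      have "k - 2 = k - 4 + 2" using k by simp
      then show ?thesis by (simp only: power_add mult.assoc)
    qed
    finally have "q * ((int x - du) * (int x - dv) + int k - 2) < (int x - 2) * (int x - 1) ^ (k - 2)"
      by (simp add: y_def)
    moreover have "falling_fact (int x) k > 0" using k by (intro falling_fact_pos) simp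
    ultimately show ?thesis by simp
  qed
  also have "\<dots> < ear_bound x k (k - 1)"
    using ear_bound_greater[of k x "k - 1"] k by (simp add: numeral_2_eq_2)
  \<comment> \<open>Here |V| = (k - 1) + (k - 2) + 2 = 2k - 1.\<close>
  also have "k - 1 = card (pverts G) - k"
  proof -
    have "card (pverts G) = card (A \<union> B) + card {u, v}"
      unfolding V(1) using V fin by (intro card_Un_disjoint) auto
    also have "card (A \<union> B) = card A + card B" using fin V(2) by (rule card_Un_disjoint)
    finally show ?thesis using V(5) card k by simp
  qed
  finally show ?thesis .
qed

end

section \<open>Graphs with a 2-vertex cut\<close>

lemma exists_inj_into:
  assumes "finite S" "finite T" "card S \<le> card T"
  obtains f where "inj_on f S" "\<And>s. s \<in> S \<Longrightarrow> f s \<in> T"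
  using card_le_inj[OF assms] by blast

lemma inj_on_fun_upd_outside:
  assumes "inj_on f (S - {z})" "\<And>s. s \<in> S \<Longrightarrow> s \<noteq> z \<Longrightarrow> f s \<noteq> y"
  shows "inj_on (f(z := y)) S"
  using assms by (auto simp: inj_on_def)

text \<open>Only the separation is assumed; that both sides are cliques is derived from the
  independence number. The two swaps below let one lemma serve all symmetric cases.\<close>

locale two_cut_graph = pair_graph G for G :: "'a pair_pre_digraph" +
  fixes A B :: "'a set" and u v :: 'a
  assumes V: "pverts G = A \<union> B \<union> {u, v}"
    and disj: "A \<inter> B = {}" "u \<notin> A" "u \<notin> B" "v \<notin> A" "v \<notin> B" "u \<noteq> v"
    and nonempty: "A \<noteq> {}" "B \<noteq> {}"
    and sep: "\<And>a b. a \<in> A \<Longrightarrow> b \<in> B \<Longrightarrow> (a, b) \<notin> parcs G"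
    and ind: "independence_number G = 2"
begin

lemma swap_sides: "two_cut_graph G B A u v"
  by unfold_locales (use V disj nonempty sep ind E_sym in blast)+

lemma swap_cut: "two_cut_graph G A B v u"
  by unfold_locales (use V disj nonempty sep ind E_sym in blast)+

lemma fin: "finite A" "finite B"
  using V pair_finite_verts by simp_all

text \<open>Two nonadjacent vertices of \<open>A\<close> would form an independent triple with any
  vertex of \<open>B\<close>.\<close>

lemma clique_A: "clique_set (parcs G) A"
proof -
  obtain b where b: "b \<in> B" using nonempty by blast
  have "(p, q) \<in> parcs G" if "p \<in> A" "q \<in> A" "p \<noteq> q" for p q
    using no_independent_triple[OF ind, of p q b] that b sep V disj by blast
  then show ?thesis by (auto simp: clique_set_def)
qed

lemma clique_B: "clique_set (parcs G) B"
  by (rule two_cut_graph.clique_A[OF swap_sides])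

text \<open>Nonneighbours of \<open>u\<close> on both sides would form an independent triple with
  \<open>u\<close>. The version for \<open>v\<close> comes from \<open>swap_cut\<close>.\<close>

lemma u_complete: "(\<forall>a\<in>A. (u, a) \<in> parcs G) \<or> (\<forall>b\<in>B. (u, b) \<in> parcs G)"
proof (rule ccontr)
  assume "\<not> ?thesis"
  then obtain a b where "a \<in> A" "(u, a) \<notin> parcs G" "b \<in> B" "(u, b) \<notin> parcs G" by blast
  then show False using no_independent_triple[OF ind, of u a b] sep V disj by blast
qed

text \<open>No arc joins \<open>A\<close> and \<open>B\<close>, so they may reuse each other's
  colours, and injectivity settles the arcs within each side. The palette \<open>S\<close> will be a
  set of vertices.\<close>

lemma chromatic_number_le_if:
  assumes "c ` pverts G \<subseteq> S" "finite S"
    and "inj_on c A" "inj_on c B"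
    and "\<And>a. a \<in> A \<Longrightarrow> (u, a) \<in> parcs G \<Longrightarrow> c u \<noteq> c a"
    and "\<And>a. a \<in> A \<Longrightarrow> (v, a) \<in> parcs G \<Longrightarrow> c v \<noteq> c a"
    and "\<And>b. b \<in> B \<Longrightarrow> (u, b) \<in> parcs G \<Longrightarrow> c u \<noteq> c b"
    and "\<And>b. b \<in> B \<Longrightarrow> (v, b) \<in> parcs G \<Longrightarrow> c v \<noteq> c b"
    and "(u, v) \<in> parcs G \<Longrightarrow> c u \<noteq> c v"
  shows "chromatic_number G \<le> card S"
proof (rule chromatic_number_le)
  show "card (c ` pverts G) \<le> card S" using assms(1,2) by (intro card_mono)
  fix p q assume pq: "(p, q) \<in> parcs G"
  have inV: "p \<in> A \<or> p \<in> B \<or> p = u \<or> p = v" "q \<in> A \<or> q \<in> B \<or> q = u \<or> q = v"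
    using in_arcsD1[OF pq] in_arcsD2[OF pq] V by auto
  have "p \<noteq> q" using pq E_irrefl by blast
  then have AB: "c p \<noteq> c q" if "p \<in> A \<and> q \<in> A \<or> p \<in> B \<and> q \<in> B"
    using that assms(3,4) by (auto dest: inj_onD)
  show "c p \<noteq> c q"
    using inV(1)
  proof (elim disjE)
    assume "p \<in> A"
    then show ?thesis using inV(2) AB sep[of p q] pq assms(5)[of p] assms(6)[of p] E_sym[OF pq] by metis
  next
    assume "p \<in> B"
    then show ?thesis using inV(2) AB sep[of q p] pq assms(7)[of p] assms(8)[of p] E_sym[OF pq] by metis
  next
    assume "p = u"
    then show ?thesis using inV(2) pq assms(5)[of q] assms(7)[of q] assms(9) \<open>p \<noteq> q\<close> by metis
  next
    assume "p = v"
    then show ?thesis using inV(2) pq assms(6)[of q] assms(8)[of q] assms(9) E_sym[OF pq] \<open>p \<noteq> q\<close> by metis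
  qed
qed

lemma clique_exists_if:
  assumes "K \<subseteq> pverts G" "clique_set (parcs G) K" "chromatic_number G \<le> card K"
  shows "\<exists>K\<subseteq>pverts G. clique_set (parcs G) K \<and> card K = chromatic_number G"
  using assms clique_card_le_chromatic_number[OF assms(1,2)] by (intro exI[of _ K]) simp

lemma clique_insert:
  assumes "clique_set (parcs G) K" "\<And>a. a \<in> K \<Longrightarrow> (w, a) \<in> parcs G"
  shows "clique_set (parcs G) (insert w K)"
  using assms E_sym by (auto simp: clique_set_def)

text \<open>The cliques \<open>insert u A\<close> and \<open>insert v B\<close> cover the graph, so
  its complement is bipartite and clique number equals chromatic number; explicit colourings show
  this here. The candidate cliques are \<open>insert u A\<close>, and \<open>A\<close> or
  \<open>B\<close> with both cut vertices.\<close>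

lemma max_clique_cobipartite:
  assumes uA: "\<And>a. a \<in> A \<Longrightarrow> (u, a) \<in> parcs G" and vB: "\<And>b. b \<in> B \<Longrightarrow> (v, b) \<in> parcs G"
    and le: "card B \<le> card A"
  shows "\<exists>K\<subseteq>pverts G. clique_set (parcs G) K \<and> card K = chromatic_number G"
proof (cases "chromatic_number G \<le> card A + 1")
  case True
  then show ?thesis
    using clique_exists_if[OF _ clique_insert[OF clique_A uA]] V fin disj by auto
next
  case False
  \<comment> \<open>\<open>B\<close> reuses colours of \<open>A\<close> while \<open>u\<close> and
    \<open>v\<close> get fresh ones, so the chromatic number is exactly |A| + 2 in this
    case.\<close>
  obtain f where f: "inj_on f B" "\<And>b. b \<in> B \<Longrightarrow> f b \<in> A"
    using exists_inj_into[OF fin(2,1) le] by blast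
  have fn: "\<And>b. b \<in> B \<Longrightarrow> u \<noteq> f b \<and> v \<noteq> f b" using f(2) disj by metis
  have "chromatic_number G \<le> card (insert u (insert v A))"
    by (rule chromatic_number_le_if[where c = "\<lambda>z. if z \<in> B then f z else z"])
      (use V disj fin f fn in \<open>auto simp: inj_on_def\<close>)
  then have chi: "chromatic_number G \<le> card A + 2" using disj fin by simp
  \<comment> \<open>Otherwise \<open>v\<close> could share the colour of \<open>u\<close>.\<close>
  have uv: "(u, v) \<in> parcs G"
  proof (rule ccontr)
    assume no: "(u, v) \<notin> parcs G"
    have "chromatic_number G \<le> card (insert u A)"
      by (rule chromatic_number_le_if[where c = "\<lambda>z. if z \<in> B then f z else if z = v then u else z"])
        (use V disj fin f fn no in \<open>auto simp: inj_on_def\<close>)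
    then show False using False disj fin by simp
  qed
  show ?thesis
  proof (cases "\<forall>a\<in>A. (v, a) \<in> parcs G")
    case True
    have "clique_set (parcs G) (insert v (insert u A))"
      using True uv E_sym by (intro clique_insert clique_A) (auto simp: uA)
    then show ?thesis using chi V disj fin by (intro clique_exists_if) auto
  next
    case False
    then obtain w where w: "w \<in> A" "(v, w) \<notin> parcs G" by blast
    have wn: "w \<noteq> u" "w \<noteq> v" "w \<notin> B" using w disj by auto
    \<comment> \<open>If \<open>B\<close> were smaller, it could be coloured from
      \<open>A - {w}\<close>, freeing the colour of \<open>w\<close> for \<open>v\<close>.\<close>
    have eq: "card A = card B"
    proof (rule ccontr)
      assume "card A \<noteq> card B"
      then have "card B \<le> card (A - {w})" using le w fin by simp
      then obtain f where f: "inj_on f B" "\<And>b. b \<in> B \<Longrightarrow> f b \<in> A - {w}"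
        using exists_inj_into[OF fin(2), of "A - {w}"] fin(1) by blast
      have fn: "\<And>b. b \<in> B \<Longrightarrow> u \<noteq> f b \<and> w \<noteq> f b \<and> f b \<in> A" using f(2) disj by blast
      have "chromatic_number G \<le> card (insert u A)"
        by (rule chromatic_number_le_if[where c = "\<lambda>z. if z \<in> B then f z else if z = v then w else z"])
          (use V disj fin f(1) fn w wn in \<open>auto simp: inj_on_def\<close>)
      then show False using \<open>\<not> chromatic_number G \<le> card A + 1\<close> disj fin by simp
    qed
    show ?thesis
    proof (cases "\<forall>b\<in>B. (u, b) \<in> parcs G")
      case True
      have "clique_set (parcs G) (insert v (insert u B))"
        using True uv E_sym by (intro clique_insert clique_B) (auto simp: vB)
      then show ?thesis using chi eq V disj fin by (intro clique_exists_if) auto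
    next
      case False
      then obtain z where z: "z \<in> B" "(u, z) \<notin> parcs G" by blast
      have zn: "z \<noteq> u" "z \<noteq> v" "z \<notin> A" using z disj by auto
      \<comment> \<open>Now \<open>v\<close> misses \<open>w\<close> in \<open>A\<close> and
        \<open>u\<close> misses \<open>z\<close> in \<open>B\<close>. Giving \<open>z\<close> the
        colour of \<open>u\<close>, \<open>v\<close> that of \<open>w\<close>, and the rest of
        \<open>B\<close> colours from \<open>A - {w}\<close> uses only |A| + 1 colours, a
        contradiction.\<close>
      have "card (B - {z}) \<le> card (A - {w})" using eq w z fin by simp
      then obtain f where f: "inj_on f (B - {z})" "\<And>b. b \<in> B - {z} \<Longrightarrow> f b \<in> A - {w}"
        using exists_inj_into[of "B - {z}" "A - {w}"] fin by blast
      have fn: "\<And>b. b \<in> B \<Longrightarrow> b \<noteq> z \<Longrightarrow> u \<noteq> f b \<and> f b \<noteq> u \<and> w \<noteq> f b \<and> f b \<in> A"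
        using f(2) disj by blast
      have "chromatic_number G \<le> card (insert u A)"
      proof -
        define c where "c = (\<lambda>a. if a \<in> B then (f(z := u)) a else if a = v then w else a)"
        have "inj_on (f(z := u)) B" using f(1) fn by (intro inj_on_fun_upd_outside) auto
        then have inj: "inj_on c B" by (unfold c_def, subst inj_on_cong[where g = "f(z := u)"]) auto
        have cb: "c b = u \<and> b = z \<or> c b \<in> A - {w}" if "b \<in> B" for b using fn that by (auto simp: c_def)
        have c: "c u = u" "c v = w" "\<And>a. a \<in> A \<Longrightarrow> c a = a" using disj by (auto simp: c_def)
        show ?thesis
        proof (rule chromatic_number_le_if[of c])
          show "inj_on c B" by (rule inj)
          show "inj_on c A" using disj by (auto simp: inj_on_def c_def)
          show "c ` pverts G \<subseteq> insert u A"
          proof (rule image_subsetI)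
            fix p assume "p \<in> pverts G"
            then have "p \<in> A \<or> p \<in> B \<or> p = u \<or> p = v" using V by auto
            then show "c p \<in> insert u A" using c cb[of p] w(1) by (elim disjE) auto
          qed
          show "c u \<noteq> c b" if "b \<in> B" "(u, b) \<in> parcs G" for b
            using cb[OF that(1)] that(2) z(2) disj(2) unfolding c(1) by (metis DiffD1)
          show "c v \<noteq> c b" if "b \<in> B" "(v, b) \<in> parcs G" for b
            using cb[OF that(1)] c(2) wn(1) by (metis DiffD2 insertI1)
          show "c u \<noteq> c a" if "a \<in> A" "(u, a) \<in> parcs G" for a
            using c(1) c(3)[OF that(1)] that(1) disj(2) by metis
          show "c v \<noteq> c a" if "a \<in> A" "(v, a) \<in> parcs G" for a
            using c(2) c(3)[OF that(1)] that(2) w(2) by metis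
          show "c u \<noteq> c v" using c(1,2) wn(1) by metis
        qed (use fin in simp)
      qed
      then show ?thesis using \<open>\<not> chromatic_number G \<le> card A + 1\<close> disj fin by simp
    qed
  qed
qed

text \<open>\<open>u\<close> takes the colour of \<open>wu\<close> and \<open>v\<close> that of
  \<open>wv\<close>, and the size condition leaves enough colours of \<open>A\<close> for
  \<open>B\<close>. As \<open>wu\<close> and \<open>wv\<close> differ, \<open>u\<close> and
  \<open>v\<close> may be adjacent.\<close>

lemma chromatic_number_le_card_A:
  assumes "wu \<in> A" "wv \<in> A" "wu \<noteq> wv" "(u, wu) \<notin> parcs G" "(v, wv) \<notin> parcs G"
    and "card B + 2 \<le> card A"
  shows "chromatic_number G \<le> card A"
proof -
  have "card B \<le> card (A - {wu, wv})"
    using assms fin by (simp add: card_Diff_subset)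
  then obtain f where f: "inj_on f B" "\<And>b. b \<in> B \<Longrightarrow> f b \<in> A - {wu, wv}"
    using exists_inj_into[OF fin(2), of "A - {wu, wv}"] fin(1) by blast
  have fn: "\<And>b. b \<in> B \<Longrightarrow> wu \<noteq> f b \<and> wv \<noteq> f b \<and> f b \<in> A" using f(2) by blast
  show ?thesis
    by (rule chromatic_number_le_if[where c =
            "\<lambda>z. if z \<in> B then f z else if z = u then wu else if z = v then wv else z"])
      (use V disj fin f(1) fn assms(1-5) in \<open>auto simp: inj_on_def\<close>)
qed

text \<open>The candidates are \<open>A\<close>, \<open>B\<close> with both cut vertices, and, when
  \<open>u\<close> and \<open>v\<close> miss only one common vertex \<open>w\<close> of
  \<open>A\<close>, the set \<open>A - {w}\<close> with both cut vertices.\<close>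

lemma max_clique_adjacent_cut:
  assumes uB: "\<And>b. b \<in> B \<Longrightarrow> (u, b) \<in> parcs G" and vB: "\<And>b. b \<in> B \<Longrightarrow> (v, b) \<in> parcs G"
    and uv: "(u, v) \<in> parcs G"
    and uA: "\<exists>a\<in>A. (u, a) \<notin> parcs G" and vA: "\<exists>a\<in>A. (v, a) \<notin> parcs G"
  shows "\<exists>K\<subseteq>pverts G. clique_set (parcs G) K \<and> card K = chromatic_number G"
proof -
  have clB: "clique_set (parcs G) (insert u (insert v B))"
    using uv by (intro clique_insert clique_B) (auto simp: uB vB)
  have cardB: "card (insert u (insert v B)) = card B + 2" using disj fin by simp
  have exB: ?thesis if "chromatic_number G \<le> card (insert u (insert v B))"
    using that clB V by (intro clique_exists_if) auto
  show ?thesis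
  proof (cases "\<exists>wu\<in>A. \<exists>wv\<in>A. wu \<noteq> wv \<and> (u, wu) \<notin> parcs G \<and> (v, wv) \<notin> parcs G")
    case True
    then obtain wu wv where w: "wu \<in> A" "wv \<in> A" "wu \<noteq> wv" "(u, wu) \<notin> parcs G" "(v, wv) \<notin> parcs G"
      by blast
    show ?thesis
    proof (cases "card B + 2 \<le> card A")
      case True
      then show ?thesis
        using chromatic_number_le_card_A[OF w] clique_A V by (intro clique_exists_if) auto
    next
      case False
      \<comment> \<open>\<open>wu\<close> and \<open>wv\<close> take the colours of \<open>u\<close>
        and \<open>v\<close>, and the rest of \<open>A\<close> reuses colours of
        \<open>B\<close>.\<close>
      then have "card (A - {wu, wv}) \<le> card B" using w fin by (simp add: card_Diff_subset)
      then obtain f where f: "inj_on f (A - {wu, wv})" "\<And>a. a \<in> A - {wu, wv} \<Longrightarrow> f a \<in> B"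
        using exists_inj_into[of "A - {wu, wv}" B] fin by blast
      have fn: "\<And>a. a \<in> A \<Longrightarrow> a \<noteq> wu \<Longrightarrow> a \<noteq> wv \<Longrightarrow> u \<noteq> f a \<and> f a \<noteq> u \<and> v \<noteq> f a \<and> f a \<noteq> v \<and> f a \<in> B"
        using f(2) disj by blast
      have wn: "wu \<noteq> u" "wu \<noteq> v" "wu \<notin> B" "wv \<noteq> u" "wv \<noteq> v" "wv \<notin> B" using w disj by auto
      have "chromatic_number G \<le> card (insert u (insert v B))"
      proof -
        define c where "c = (\<lambda>z. if z \<in> A then (f(wu := u, wv := v)) z else z)"
        have "A - {wu, wv} = A - {wv} - {wu}" by blast
        then have "inj_on (f(wu := u)) (A - {wv})"
          using f(1) fn by (intro inj_on_fun_upd_outside) auto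
        then have "inj_on (f(wu := u, wv := v)) A"
          by (rule inj_on_fun_upd_outside) (use fn disj in auto)
        then have inj: "inj_on c A" by (unfold c_def, subst inj_on_cong[where g = "f(wu := u, wv := v)"]) auto
        have ca: "c a = u \<and> a = wu \<or> c a = v \<and> a = wv \<or> c a \<in> B" if "a \<in> A" for a
          using fn that by (auto simp: c_def)
        have c: "c u = u" "c v = v" "\<And>b. b \<in> B \<Longrightarrow> c b = b" using disj by (auto simp: c_def)
        show ?thesis
        proof (rule chromatic_number_le_if[of c])
          show "inj_on c A" by (rule inj)
          show "inj_on c B" using disj by (auto simp: inj_on_def c_def)
          show "c ` pverts G \<subseteq> insert u (insert v B)"
          proof (rule image_subsetI)
            fix p assume "p \<in> pverts G"
            then have "p \<in> A \<or> p \<in> B \<or> p = u \<or> p = v" using V by auto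
            then show "c p \<in> insert u (insert v B)" using c ca[of p] by (elim disjE) auto
          qed
          show "c u \<noteq> c b" if "b \<in> B" "(u, b) \<in> parcs G" for b
            using c that disj by metis
          show "c v \<noteq> c b" if "b \<in> B" "(v, b) \<in> parcs G" for b
            using c that disj by metis
          show "c u \<noteq> c a" if "a \<in> A" "(u, a) \<in> parcs G" for a
            using ca[OF that(1)] c(1) that w(4) disj by metis
          show "c v \<noteq> c a" if "a \<in> A" "(v, a) \<in> parcs G" for a
            using ca[OF that(1)] c(2) that w(5) disj by metis
          show "c u \<noteq> c v" using c disj by metis
        qed (use fin in simp)
      qed
      then show ?thesis by (rule exB)
    qed
  next
    case False
    \<comment> \<open>Without a choice of distinct nonneighbours, \<open>u\<close> and
      \<open>v\<close> miss exactly one and the same vertex of \<open>A\<close>.\<close>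
    then have eq: "wu = wv"
      if "wu \<in> A" "wv \<in> A" "(u, wu) \<notin> parcs G" "(v, wv) \<notin> parcs G" for wu wv
      using that by blast
    obtain w wv where w: "w \<in> A" "(u, w) \<notin> parcs G" and wv: "wv \<in> A" "(v, wv) \<notin> parcs G"
      using uA vA by blast
    have "w = wv" by (rule eq[OF w(1) wv(1) w(2) wv(2)])
    then have w: "w \<in> A" "(u, w) \<notin> parcs G" "(v, w) \<notin> parcs G" using w wv by auto
    have nbr: "(u, a) \<in> parcs G \<and> (v, a) \<in> parcs G" if "a \<in> A - {w}" for a
      using eq[of a w] eq[of w a] w that by blast
    have wn: "w \<noteq> u" "w \<noteq> v" "w \<notin> B" using w disj by auto
    have "clique_set (parcs G) (A - {w})" using clique_A by (auto simp: clique_set_def)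
    then have clA: "clique_set (parcs G) (insert u (insert v (A - {w})))"
      using uv by (intro clique_insert) (auto simp: nbr)
    \<comment> \<open>In both cases \<open>w\<close> takes the colour of \<open>u\<close>, and of
      \<open>A - {w}\<close> and \<open>B\<close> the smaller is coloured from the larger.\<close>
    show ?thesis
    proof (cases "card (A - {w}) \<le> card B")
      case True
      then obtain f where f: "inj_on f (A - {w})" "\<And>a. a \<in> A - {w} \<Longrightarrow> f a \<in> B"
        using exists_inj_into[of "A - {w}" B] fin by blast
      have fn: "\<And>a. a \<in> A \<Longrightarrow> a \<noteq> w \<Longrightarrow> u \<noteq> f a \<and> f a \<noteq> u \<and> v \<noteq> f a \<and> f a \<in> B"
        using f(2) disj by blast
      have "chromatic_number G \<le> card (insert u (insert v B))"
      proof -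
        define c where "c = (\<lambda>z. if z \<in> A then (f(w := u)) z else z)"
        have "inj_on (f(w := u)) A" using f(1) fn by (intro inj_on_fun_upd_outside) auto
        then have inj: "inj_on c A" by (unfold c_def, subst inj_on_cong[where g = "f(w := u)"]) auto
        have ca: "c a = u \<and> a = w \<or> c a \<in> B" if "a \<in> A" for a
          using fn that by (auto simp: c_def)
        have c: "c u = u" "c v = v" "\<And>b. b \<in> B \<Longrightarrow> c b = b" using disj by (auto simp: c_def)
        show ?thesis
        proof (rule chromatic_number_le_if[of c])
          show "c ` pverts G \<subseteq> insert u (insert v B)"
          proof (rule image_subsetI)
            fix p assume "p \<in> pverts G"
            then have "p \<in> A \<or> p \<in> B \<or> p = u \<or> p = v" using V by auto
            then show "c p \<in> insert u (insert v B)" using c ca[of p] by (elim disjE) auto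
          qed
          show "inj_on c A" by (rule inj)
          show "inj_on c B" using disj by (auto simp: inj_on_def c_def)
          show "c u \<noteq> c b" if "b \<in> B" "(u, b) \<in> parcs G" for b
            using c(1) c(3)[OF that(1)] that(1) disj by metis
          show "c v \<noteq> c b" if "b \<in> B" "(v, b) \<in> parcs G" for b
            using c(2) c(3)[OF that(1)] that(1) disj by metis
          show "c u \<noteq> c a" if "a \<in> A" "(u, a) \<in> parcs G" for a
            using ca[OF that(1)] c(1) that(2) w(2) disj by metis
          show "c v \<noteq> c a" if "a \<in> A" "(v, a) \<in> parcs G" for a
            using ca[OF that(1)] c(2) disj by metis
          show "c u \<noteq> c v" using c(1,2) disj by metis
        qed (use fin in simp)
      qed
      then show ?thesis by (rule exB)
    next
      case False
      then obtain f where f: "inj_on f B" "\<And>b. b \<in> B \<Longrightarrow> f b \<in> A - {w}"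
        using exists_inj_into[of B "A - {w}"] fin by auto
      have fn: "\<And>b. b \<in> B \<Longrightarrow> u \<noteq> f b \<and> v \<noteq> f b \<and> w \<noteq> f b \<and> f b \<in> A" using f(2) disj by blast
      have "chromatic_number G \<le> card (insert u (insert v (A - {w})))"
      proof -
        define c where "c = (\<lambda>z. if z = w then u else if z \<in> B then f z else z)"
        have cb: "c b = f b" "f b \<in> A - {w}" if "b \<in> B" for b
          using f(2)[OF that] that wn(3) by (auto simp: c_def)
        have ca: "c a = a" if "a \<in> A - {w}" for a using that disj by (auto simp: c_def)
        have c: "c u = u" "c v = v" "c w = u" using disj wn by (auto simp: c_def)
        show ?thesis
        proof (rule chromatic_number_le_if[of c])
          show "c ` pverts G \<subseteq> insert u (insert v (A - {w}))"
          proof (rule image_subsetI)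
            fix p assume "p \<in> pverts G"
            then have "p \<in> A - {w} \<or> p = w \<or> p \<in> B \<or> p = u \<or> p = v" using V by auto
            then show "c p \<in> insert u (insert v (A - {w}))"
              using c cb[of p] ca[of p] by (elim disjE) auto
          qed
          show "inj_on c A" using disj by (auto simp: inj_on_def c_def)
          show "inj_on c B" by (subst inj_on_cong[where g = f]) (use cb f(1) in auto)
          show "c u \<noteq> c b" if "b \<in> B" "(u, b) \<in> parcs G" for b
            using cb[OF that(1)] c(1) disj by auto
          show "c v \<noteq> c b" if "b \<in> B" "(v, b) \<in> parcs G" for b
            using cb[OF that(1)] c(2) disj by auto
          show "c u \<noteq> c a" if "a \<in> A" "(u, a) \<in> parcs G" for a
            using ca[of a] c(1) that w(2) disj by (cases "a = w") auto
          show "c v \<noteq> c a" if "a \<in> A" "(v, a) \<in> parcs G" for a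
            using ca[of a] c(2) that w(3) disj by (cases "a = w") auto
          show "c u \<noteq> c v" using c(1,2) disj by metis
        qed (use fin in simp)
      qed
      then show ?thesis using clA V by (intro clique_exists_if) auto
    qed
  qed
qed

text \<open>As \<open>u\<close> and \<open>v\<close> are nonadjacent, no vertex of \<open>A\<close>
  misses both, so \<open>wu\<close> and \<open>wv\<close> differ. Colourings settle everything
  except |A| = |B| + 1 with chromatic number |A| + 1.\<close>

lemma max_clique_or_exceptional:
  assumes uB: "\<And>b. b \<in> B \<Longrightarrow> (u, b) \<in> parcs G" and vB: "\<And>b. b \<in> B \<Longrightarrow> (v, b) \<in> parcs G"
    and uv: "(u, v) \<notin> parcs G"
    and uA: "\<exists>a\<in>A. (u, a) \<notin> parcs G" and vA: "\<exists>a\<in>A. (v, a) \<notin> parcs G"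
    and x: "chromatic_number G \<ge> 4" "x \<ge> chromatic_number G"
  shows "(\<exists>K\<subseteq>pverts G. clique_set (parcs G) K \<and> card K = chromatic_number G) \<or>
    int (chromatic_poly G x) < ear_bound x (chromatic_number G) (card (pverts G) - chromatic_number G)"
proof -
  have cover: "(u, a) \<in> parcs G \<or> (v, a) \<in> parcs G" if "a \<in> A" for a
    using no_independent_triple[OF ind, of u v a] that uv V disj by blast
  obtain wu wv where w: "wu \<in> A" "wv \<in> A" "(u, wu) \<notin> parcs G" "(v, wv) \<notin> parcs G"
    using uA vA by blast
  have ww: "wu \<noteq> wv" using cover w by blast
  have exA: ?thesis if "chromatic_number G \<le> card A"
    using clique_exists_if[OF _ clique_A that] V by auto
  consider "card A \<le> card B" | "card B + 2 \<le> card A" | "card A = card B + 1" by linarith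
  then show ?thesis
  proof cases
    case 1
    then obtain f where f: "inj_on f A" "\<And>a. a \<in> A \<Longrightarrow> f a \<in> B"
      using exists_inj_into[OF fin] by blast
    have fn: "\<And>a. a \<in> A \<Longrightarrow> u \<noteq> f a \<and> f a \<in> B" using f(2) disj by blast
    \<comment> \<open>\<open>v\<close> shares the colour of \<open>u\<close> and \<open>A\<close> is
      coloured from \<open>B\<close>; the palette \<open>insert u B\<close> is itself a
      clique.\<close>
    have "chromatic_number G \<le> card (insert u B)"
      by (rule chromatic_number_le_if[where c = "\<lambda>z. if z \<in> A then f z else if z = v then u else z"])
        (use V disj fin f(1) fn uv in \<open>auto simp: inj_on_def\<close>)
    then show ?thesis
      using clique_exists_if[OF _ clique_insert[OF clique_B uB]] V by auto
  next
    case 2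
    then show ?thesis using exA chromatic_number_le_card_A[OF w(1,2) ww w(3,4)] by blast
  next
    case 3
    then have "card (A - {wu}) \<le> card B" using w fin by simp
    then obtain f where f: "inj_on f (A - {wu})" "\<And>a. a \<in> A - {wu} \<Longrightarrow> f a \<in> B"
      using exists_inj_into[of "A - {wu}" B] fin by blast
    have wn: "wu \<noteq> u" "wu \<noteq> v" "wu \<notin> B" using w disj by auto
    have fn: "\<And>a. a \<in> A \<Longrightarrow> a \<noteq> wu \<Longrightarrow> u \<noteq> f a \<and> wu \<noteq> f a \<and> f a \<noteq> wu \<and> f a \<in> B"
      using f(2) disj wn by blast
    \<comment> \<open>\<open>u\<close> and \<open>v\<close> share a colour, \<open>wu\<close> keeps
      its own and the rest of \<open>A\<close> is coloured from \<open>B\<close>: |B| + 2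
      colours.\<close>
    have "chromatic_number G \<le> card (insert wu (insert u B))"
    proof -
      define c where "c = (\<lambda>z. if z \<in> A then (f(wu := wu)) z else if z = v then u else z)"
      have "inj_on (f(wu := wu)) A" using f(1) fn by (intro inj_on_fun_upd_outside) auto
      then have inj: "inj_on c A" by (unfold c_def, subst inj_on_cong[where g = "f(wu := wu)"]) auto
      have ca: "c a = wu \<or> c a \<in> B" if "a \<in> A" for a using fn that by (auto simp: c_def)
      have c: "c u = u" "c v = u" "\<And>b. b \<in> B \<Longrightarrow> c b = b" using disj by (auto simp: c_def)
      show ?thesis
      proof (rule chromatic_number_le_if[of c])
        show "c ` pverts G \<subseteq> insert wu (insert u B)"
        proof (rule image_subsetI)
          fix p assume "p \<in> pverts G"
          then have "p \<in> A \<or> p \<in> B \<or> p = u \<or> p = v" using V by auto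
          then show "c p \<in> insert wu (insert u B)" using c ca[of p] by (elim disjE) auto
        qed
        show "inj_on c A" by (rule inj)
        show "inj_on c B" using disj by (auto simp: inj_on_def c_def)
        show "c u \<noteq> c b" if "b \<in> B" "(u, b) \<in> parcs G" for b
          using c that disj by metis
        show "c v \<noteq> c b" if "b \<in> B" "(v, b) \<in> parcs G" for b
          using c that disj by metis
        show "c u \<noteq> c a" if "a \<in> A" "(u, a) \<in> parcs G" for a
          using ca[OF that(1)] c(1) disj wn by metis
        show "c v \<noteq> c a" if "a \<in> A" "(v, a) \<in> parcs G" for a
          using ca[OF that(1)] c(2) disj wn by metis
        show "c u \<noteq> c v" if "(u, v) \<in> parcs G" using that uv by blast
      qed (use fin in simp)
    qed
    also have "\<dots> = card A + 1" using 3 wn disj fin by simp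
    finally have chi: "chromatic_number G \<le> card A + 1" .
    show ?thesis
    proof (cases "chromatic_number G \<le> card A")
      case True
      then show ?thesis by (rule exA)
    next
      case False
      \<comment> \<open>Now k = |A| + 1 = |B| + 2, the sizes required by
        \<open>exceptional_less\<close>.\<close>
      then have chi: "chromatic_number G = card A + 1" using chi by simp
      have "\<exists>a\<in>A. (u, a) \<in> parcs G" "\<exists>a\<in>A. (v, a) \<in> parcs G" using cover w by blast+
      then have "int (chromatic_poly G x) <
          ear_bound x (chromatic_number G) (card (pverts G) - chromatic_number G)"
        using V disj cover uB vB uv sep clique_A clique_B x chi 3
        by (intro exceptional_less[of A B u v]) auto
      then show ?thesis by blast
    qed
  qed
qed

end

section \<open>Combining the cases of a 2-vertex cut\<close>

lemma (in two_cut_graph) max_clique_or_less: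
  assumes x: "chromatic_number G \<ge> 4" "x \<ge> chromatic_number G"
  shows "(\<exists>K\<subseteq>pverts G. clique_set (parcs G) K \<and> card K = chromatic_number G) \<or>
    int (chromatic_poly G x) < ear_bound x (chromatic_number G) (card (pverts G) - chromatic_number G)"
    (is "?clique \<or> ?less")
proof -
  \<comment> \<open>The cut vertices are complete to different sides; swapping both pairs puts the
    larger side first.\<close>
  have diag: ?clique
    if "two_cut_graph G A' B' p q" "\<forall>a\<in>A'. (p, a) \<in> parcs G" "\<forall>b\<in>B'. (q, b) \<in> parcs G"
    for A' B' p q
  proof -
    interpret C: two_cut_graph G A' B' p q by fact
    show ?clique
    proof (cases "card B' \<le> card A'")
      case True
      then show ?thesis using that(2,3) by (intro C.max_clique_cobipartite) auto
    next
      case False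
      interpret D: two_cut_graph G B' A' q p
        by (rule two_cut_graph.swap_cut[OF C.swap_sides])
      show ?thesis using that(2,3) False by (intro D.max_clique_cobipartite) auto
    qed
  qed
  \<comment> \<open>Both cut vertices are complete to \<open>B'\<close>. If one of them is also
    complete to \<open>A'\<close>, the previous case applies.\<close>
  have same: "?clique \<or> ?less"
    if "two_cut_graph G A' B' u v" "\<forall>b\<in>B'. (u, b) \<in> parcs G" "\<forall>b\<in>B'. (v, b) \<in> parcs G"
    for A' B'
  proof -
    interpret C: two_cut_graph G A' B' u v by fact
    consider "\<forall>a\<in>A'. (u, a) \<in> parcs G" | "\<forall>a\<in>A'. (v, a) \<in> parcs G"
      | "\<exists>a\<in>A'. (u, a) \<notin> parcs G" "\<exists>a\<in>A'. (v, a) \<notin> parcs G" by blast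
    then show ?thesis
    proof cases
      case 1
      then show ?thesis using diag[OF that(1)] that(3) by blast
    next
      case 2
      then show ?thesis using diag[OF C.swap_cut] that(2) by blast
    next
      case 3
      then show ?thesis
        using C.max_clique_adjacent_cut C.max_clique_or_exceptional[OF _ _ _ _ _ x] that(2,3)
        by (cases "(u, v) \<in> parcs G") auto
    qed
  qed
  have self: "two_cut_graph G A B u v" by unfold_locales
  interpret S: two_cut_graph G A B v u by (rule swap_cut)
  show ?thesis
    using u_complete S.u_complete same[OF self] same[OF swap_sides] diag[OF self] diag[OF swap_cut]
    by blast
qed

lemma (in pair_graph) two_cut_graphE:
  assumes "vertex_connectivity G = 2" "independence_number G = 2" "card (pverts G) > 3"
  obtains A B u v where "two_cut_graph G A B u v"
proof -
  have "2 + 1 < card (pverts G)" using assms(3) by simp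
  from vertex_cut_exists[OF assms(1) this] obtain S where S: "S \<subseteq> pverts G" "card S = 2"
    "\<not> Digraph_Component.connected (with_proj G \<restriction> (pverts G - S))" .
  obtain u v where uv: "S = {u, v}" "u \<noteq> v" using S(2) by (auto simp: card_2_iff)
  have "pverts G - S \<noteq> {}"
  proof
    assume "pverts G - S = {}"
    then have "pverts G = S" using S(1) by blast
    then show False using S(2) assms(3) by simp
  qed
  from not_connected_induce_separation[OF S(3) this] obtain A B where AB: "A \<noteq> {}" "B \<noteq> {}"
    "A \<union> B = pverts G - S" "A \<inter> B = {}" "\<And>a b. a \<in> A \<Longrightarrow> b \<in> B \<Longrightarrow> (a, b) \<notin> parcs G"
    by metis
  have "two_cut_graph G A B u v"
  proof unfold_locales
    show "pverts G = A \<union> B \<union> {u, v}" using AB(3) S(1) uv(1) by blast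
  qed (use AB uv assms(2) in auto)
  then show ?thesis by (rule that)
qed

theorem theorem3p9:
  fixes G :: "'a pair_pre_digraph" and k n :: nat
  assumes "pair_graph G"
    and "k \<ge> 4" and "n > k"
    and "card (pverts G) = n"
    and "k_connected 2 G"
    and "chromatic_number G = k"
    and "independence_number G = 2"
    and "vertex_connectivity G = 2"
  shows "\<forall>x::nat. x \<ge> k \<longrightarrow>
    int (chromatic_poly G x)
      \<le> falling_fact (int x - 1) (k - 1) * ((int x - 1) ^ (n - k + 1) + (-1) ^ (n - k)) \<and>
    (int (chromatic_poly G x)
      = falling_fact (int x - 1) (k - 1) * ((int x - 1) ^ (n - k + 1) + (-1) ^ (n - k))
     \<longleftrightarrow> G \<simeq>\<^sub>G clique_with_ear (k + 1) k \<or> G \<simeq>\<^sub>G clique_with_ear (k + 2) k)"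
proof (intro allI impI)
  fix x :: nat assume x: "x \<ge> k"
  interpret pair_graph G by fact
  have bound: "falling_fact (int x - 1) (k - 1) * ((int x - 1) ^ (n - k + 1) + (-1) ^ (n - k)) =
    ear_bound x k (n - k)"
    by (simp add: ear_bound_def)
  \<comment> \<open>An isomorphism fixes the number of vertices, so n - k is 1 here and 2 in
    \<open>iso2\<close>, and the bound is the exact polynomial.\<close>
  have iso1: "int (chromatic_poly G x) = ear_bound x k (n - k)"
    if "G \<simeq>\<^sub>G clique_with_ear (k + 1) k"
    using graph_iso_card[OF that assms(1)] chromatic_poly_iso[OF that assms(1), of x]
      chromatic_poly_clique_with_ear_1[of k x] assms(2,4)
    unfolding clique_with_ear_1(1) by simp
  have iso2: "int (chromatic_poly G x) = ear_bound x k (n - k)"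
    if "G \<simeq>\<^sub>G clique_with_ear (k + 2) k"
    using graph_iso_card[OF that assms(1)] chromatic_poly_iso[OF that assms(1), of x]
      chromatic_poly_clique_with_ear_2[of k x] assms(2,4)
    unfolding clique_with_ear_2(1) by simp
  have "3 < card (pverts G)" using assms(2-4) by simp
  from two_cut_graphE[OF assms(8,7) this] obtain A B u v where "two_cut_graph G A B u v" .
  then interpret two_cut_graph G A B u v .
  have "k \<ge> 3" "k < card (pverts G)" using assms(2-4) by auto
  note iso_or_less = clique_iso_or_less[OF assms(5,7) _ _ _ this x, unfolded assms(4)]
  have "(\<exists>K\<subseteq>pverts G. clique_set (parcs G) K \<and> card K = k) \<or>
    int (chromatic_poly G x) < ear_bound x k (n - k)"
    using max_clique_or_less[of x] assms(2) x unfolding assms(4,6) by blast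
  then have "G \<simeq>\<^sub>G clique_with_ear (k + 1) k \<or> G \<simeq>\<^sub>G clique_with_ear (k + 2) k \<or>
    int (chromatic_poly G x) < ear_bound x k (n - k)"
    using iso_or_less by blast
  \<comment> \<open>The strict alternative excludes equality, so equality forces one of the
    isomorphisms; \<open>iso1\<close> and \<open>iso2\<close> give the converse.\<close>
  then show "int (chromatic_poly G x)
      \<le> falling_fact (int x - 1) (k - 1) * ((int x - 1) ^ (n - k + 1) + (-1) ^ (n - k)) \<and>
    (int (chromatic_poly G x)
      = falling_fact (int x - 1) (k - 1) * ((int x - 1) ^ (n - k + 1) + (-1) ^ (n - k))
     \<longleftrightarrow> G \<simeq>\<^sub>G clique_with_ear (k + 1) k \<or> G \<simeq>\<^sub>G clique_with_ear (k + 2) k)"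
    unfolding bound using iso1 iso2 by auto
qed

end
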